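(* Let $\{s_n\}_{n\in\mathbb{N}}\subset(0,1)$ be such that $s_n\to0$ as $n\to+\infty$. Let $\{E_n\}_{n\in\mathbb{N}}\subset\mathfrak{C}$ be such that $E_n\to E$ in $\mathfrak{C}$ for some $E\in\mathfrak{C}$. For every $x\in\partial E\cap\partial E_n$ (i.e. $x$ belonging to $\partial E$ and to $\partial E_n$ for all $n$) it holds $$\lim_{n\to+\infty}\Big(\mathrm{H}^{s_n}(x,E_n)-\frac{d\omega_d}{s_n}\Big)=\mathrm{H}^0(x,E).$$ In particular, $$\lim_{n\to+\infty}s_n\mathrm{H}^{s_n}(x,E_n)=d\omega_d.$$
   Context: $\omega_d$ is the volume of the unit ball of $\mathbb{R}^d$. Fix an integer $\ell\ge 2$ and $\beta\in[0,1]$. $\mathfrak{C}$ is the class of subsets of $\mathbb{R}^d$ that are the closure of an open set with compact $C^{\ell,\beta}$ boundary. $E_n\to E$ in $\mathfrak{C}$ means that there are diffeomorphisms $\Phi_n$ converging to the identity in $C^{\ell,\beta}$ with $E_n=\Phi_n(E)$. $B_\rho(x)$ is the open ball of radius $\rho$ centred at $x$. For $s\in(0,1)$, $E\in\mathfrak{C}$, $x\in\partial E$, the $s$-fractional curvature is $$\mathrm{H}^s(x,E)=\lim_{r\to0^+}\int_{\mathbb{R}^d\setminus B_r(x)}\frac{\chi_{\mathbb{R}^d\setminus E}(y)-\chi_E(y)}{|x-y|^{d+s}}\,dy.$$ The $0$-fractional curvature is $$\mathrm{H}^0(x,E)=\lim_{R\to+\infty}\Big[\lim_{r\to0^+}\int_{B_R(x)\setminus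 B_r(x)}\frac{\chi_{\mathbb{R}^d\setminus E}(y)-\chi_E(y)}{|x-y|^{d}}\,dy-d\omega_d\log R\Big]\quad\text{if }E\text{ is bounded},$$ $$\mathrm{H}^0(x,E)=\lim_{R\to+\infty}\Big[\lim_{r\to0^+}\int_{B_R(x)\setminus B_r(x)}\frac{\chi_{\mathbb{R}^d\setminus E}(y)-\chi_E(y)}{|x-y|^{d}}\,dy+d\omega_d\log R\Big]\quad\text{if }\mathbb{R}^d\setminus E\text{ is bounded}.$$
   Formalization: For E bounded the claim is as stated; for R^d∖E bounded it fails as written (e.g. E_n=E the complement of an open ball), and is proved with dω_d replaced by −dω_d in both limits; nothing is claimed when neither is bounded (d=1), where H^0 is undefined. *)

theory Defs
  imports "HOL-Analysis.Analysis"
begin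

text \<open>The space \<open>\<real>\<^sup>d\<close> is an arbitrary type of class \<open>euclidean_space\<close>, with \<open>d = DIM('a)\<close>.\<close>

text \<open>\<open>C\<^sup>k\<close> regularity on the whole space; all directional derivatives being \<open>C\<^sup>k\<close> amounts to the
  Frechet derivative being \<open>C\<^sup>k\<close>, as the dimension is finite.\<close>

primrec Ck :: "nat \<Rightarrow> ('a::euclidean_space \<Rightarrow> 'b::real_normed_vector) \<Rightarrow> bool" where
  "Ck 0 f \<longleftrightarrow> continuous_on UNIV f"
| "Ck (Suc k) f \<longleftrightarrow>
     (\<forall>x. f differentiable (at x)) \<and> (\<forall>v. Ck k (\<lambda>x. frechet_derivative f (at x) v))"

primrec iter_partial ::
    "'a list \<Rightarrow> ('a::euclidean_space \<Rightarrow> 'b::real_normed_vector) \<Rightarrow> 'a \<Rightarrow> 'b" where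
  "iter_partial [] f = f"
| "iter_partial (v # vs) f = (\<lambda>x. frechet_derivative (iter_partial vs f) (at x) v)"

text \<open>The \<open>C\<^sup>l\<^sup>,\<^sup>\<beta>\<close> norm on the whole space, possibly infinite. It is meaningful only for functions
  satisfying \<open>Ck l\<close>. Lists of basis vectors play the role of multi-indices, so mixed derivatives
  are counted once for each order of differentiation, which gives an equivalent norm.
  For \<open>\<beta> = 0\<close> the last sum is at most twice the first one.\<close>

definition holder_norm ::
    "nat \<Rightarrow> real \<Rightarrow> ('a::euclidean_space \<Rightarrow> 'b::real_normed_vector) \<Rightarrow> ennreal" where
  "holder_norm l \<beta> f =
     (\<Sum>I | set I \<subseteq> Basis \<and> length I \<le> l. SUP x. ennreal (norm (iter_partial I f x))) +
     (\<Sum>I | set I \<subseteq> Basis \<and> length I = l.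
        SUP (x, y)\<in>{(x, y). x \<noteq> y}.
          ennreal (norm (iter_partial I f x - iter_partial I f y) / dist x y powr \<beta>))"

text \<open>The open set \<open>U\<close> has \<open>C\<^sup>l\<^sup>,\<^sup>\<beta>\<close> boundary: near each boundary point, \<open>U\<close> is the region above the
  graph, in some unit direction \<open>\<nu>\<close>, of a \<open>C\<^sup>l\<^sup>,\<^sup>\<beta>\<close> function \<open>\<gamma>\<close> on the hyperplane orthogonal to \<open>\<nu>\<close>.
  To avoid a type for the hyperplane, \<open>\<gamma>\<close> is defined on the whole space but only evaluated at
  orthogonal projections \<open>y - (y \<bullet> \<nu>) \<nu>\<close>. Asking \<open>\<gamma>\<close> to be globally defined with finite norm is no
  restriction, by a cut-off and a smaller \<open>\<rho>\<close>.\<close>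

definition holder_boundary :: "nat \<Rightarrow> real \<Rightarrow> 'a::euclidean_space set \<Rightarrow> bool" where
  "holder_boundary l \<beta> U \<longleftrightarrow>
     (\<forall>p\<in>frontier U. \<exists>\<rho>>0. \<exists>\<nu>. \<exists>\<gamma> :: 'a \<Rightarrow> real.
        norm \<nu> = 1 \<and> Ck l \<gamma> \<and> holder_norm l \<beta> \<gamma> < \<infinity> \<and>
        U \<inter> ball p \<rho> = {y \<in> ball p \<rho>. \<gamma> (y - (y \<bullet> \<nu>) *\<^sub>R \<nu>) < y \<bullet> \<nu>})"

definition class_C :: "nat \<Rightarrow> real \<Rightarrow> 'a::euclidean_space set set" where
  "class_C l \<beta> =
     {E. \<exists>U. open U \<and> compact (frontier U) \<and> holder_boundary l \<beta> U \<and> E = closure U}"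

definition Ck_diffeo :: "nat \<Rightarrow> ('a::euclidean_space \<Rightarrow> 'a) \<Rightarrow> bool" where
  "Ck_diffeo l \<Phi> \<longleftrightarrow> bij \<Phi> \<and> Ck l \<Phi> \<and> Ck l (inv \<Phi>)"

definition converges_C ::
    "nat \<Rightarrow> real \<Rightarrow> (nat \<Rightarrow> 'a::euclidean_space set) \<Rightarrow> 'a set \<Rightarrow> bool" where
  "converges_C l \<beta> En E \<longleftrightarrow>
     (\<exists>\<Phi>. (\<forall>n. Ck_diffeo l (\<Phi> n) \<and> En n = \<Phi> n ` E) \<and>
          (\<lambda>n. holder_norm l \<beta> (\<lambda>x. \<Phi> n x - x)) \<longlonglongrightarrow> 0)"

text \<open>The constant \<open>d \<omega>\<^sub>d\<close>, the space being passed as a type.\<close>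

definition dim_omega :: "'a::euclidean_space itself \<Rightarrow> real" where
  "dim_omega _ = real DIM('a) * measure lebesgue (ball (0::'a) 1)"

definition frac_curv :: "real \<Rightarrow> 'a::euclidean_space \<Rightarrow> 'a set \<Rightarrow> real" where
  "frac_curv s x E =
     Lim (at_right 0) (\<lambda>r.
       LINT y : UNIV - ball x r | lebesgue.
         (indicator (UNIV - E) y - indicator E y) / norm (x - y) powr (real DIM('a) + s))"

definition trunc_curv0 :: "real \<Rightarrow> 'a::euclidean_space \<Rightarrow> 'a set \<Rightarrow> real" where
  "trunc_curv0 R x E =
     Lim (at_right 0) (\<lambda>r.
       LINT y : ball x R - ball x r | lebesgue.
         (indicator (UNIV - E) y - indicator E y) / norm (x - y) ^ DIM('a))"

text \<open>Neither case applies e.g. to a half-line in dimension one; the value is then unspecified.\<close>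

definition frac_curv0 :: "'a::euclidean_space \<Rightarrow> 'a set \<Rightarrow> real" where
  "frac_curv0 x E =
     (if bounded E
      then Lim at_top (\<lambda>R. trunc_curv0 R x E - dim_omega TYPE('a) * ln R)
      else if bounded (UNIV - E)
      then Lim at_top (\<lambda>R. trunc_curv0 R x E + dim_omega TYPE('a) * ln R)
      else undefined)"

end

theory Submission
  imports Defs
begin

text \<open>Near \<open>x\<close> the reflection \<open>y \<mapsto> 2 x - y\<close> cancels the integrand except on points \<open>y\<close> with
  \<open>\<bar>w \<bullet> (y - x)\<bar> \<le> C \<bar>y - x\<bar>\<^sup>2\<close>, where \<open>w\<close> is normal to the boundary of \<open>E\<^sub>n\<close> at \<open>x\<close>. This slab
  has volume \<open>O(R\<^sup>d\<^sup>+\<^sup>1)\<close> in the ball of radius \<open>R\<close>, so that, summing over dyadic annuli, the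
  integrals over annuli of outer radius \<open>R\<close> are \<open>O(\<surd>R)\<close>, uniformly in \<open>n\<close> and in \<open>s \<le> 1/2\<close>: the
  constant \<open>C\<close> is uniform because the diffeomorphisms converge in \<open>C\<^sup>2\<close>. Hence the limits \<open>r \<rightarrow> 0\<close>
  and \<open>n \<rightarrow> \<infinity>\<close> can be exchanged. Outside a large ball of radius \<open>R\<close> the integrand is radial and
  contributes \<open>\<sigma> d \<omega>\<^sub>d R\<^sup>-\<^sup>s / s\<close>, where \<open>\<sigma> = 1\<close> if \<open>E\<close> is bounded and \<open>\<sigma> = -1\<close> otherwise; its
  difference to \<open>\<sigma> d \<omega>\<^sub>d / s\<close> tends to \<open>- \<sigma> d \<omega>\<^sub>d log R\<close>.\<close>

section \<open>Radial integrals and slabs\<close>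

lemma dim_omega_unit_ball_vol:
  "dim_omega TYPE('a::euclidean_space) = real DIM('a) * unit_ball_vol (real DIM('a))"
  by (simp add: dim_omega_def content_ball)

lemma dim_omega_nonneg: "0 \<le> dim_omega TYPE('a::euclidean_space)"
  by (simp add: dim_omega_def)

text \<open>Polar coordinates. The half-lines \<open>{..a}\<close> form an intersection-stable
  generator of the Borel sets, and on them both measures give the volume of a ball of radius
  \<open>a\<close>: the density is the derivative of that volume.\<close>

lemma distr_lborel_norm:
  "distr (lborel :: 'a::euclidean_space measure) borel norm =
     density lborel (\<lambda>r. ennreal (dim_omega TYPE('a) * r ^ (DIM('a) - 1)) * indicator {0..} r)"
  (is "?M = ?N")
proof (rule measure_eqI_generator_eq[where E = "range (\<lambda>a::real. {..a})" and \<Omega> = UNIV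
      and A = "\<lambda>i. {..real i}"])
  have M_eq: "emeasure ?M {..a} =
      (if a < 0 then 0 else ennreal (unit_ball_vol (real DIM('a)) * a ^ DIM('a)))" for a
  proof -
    have "norm -` {..a} \<inter> space lborel = cball (0::'a) a" by (auto simp: dist_norm)
    then have "emeasure ?M {..a} = emeasure lborel (cball (0::'a) a)"
      by (simp add: emeasure_distr)
    then show ?thesis by (simp add: emeasure_cball)
  qed
  have N_eq: "emeasure ?N {..a} =
      (if a < 0 then 0 else ennreal (unit_ball_vol (real DIM('a)) * a ^ DIM('a)))" for a
  proof (cases "a < 0")
    case True
    have "emeasure ?N {..a} = (\<integral>\<^sup>+r. ennreal (dim_omega TYPE('a) * r ^ (DIM('a) - 1)) *
        indicator {0..} r * indicator {..a} r \<partial>lborel)"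
      by (subst emeasure_density) auto
    also have "\<dots> = (\<integral>\<^sup>+r. 0 \<partial>(lborel :: real measure))"
      using True by (intro nn_integral_cong) (auto split: split_indicator)
    finally show ?thesis using True by simp
  next
    case False
    have "emeasure ?N {..a} = (\<integral>\<^sup>+r. ennreal (dim_omega TYPE('a) * r ^ (DIM('a) - 1)) *
        indicator {0..} r * indicator {..a} r \<partial>lborel)"
      by (subst emeasure_density) auto
    also have "\<dots> = (\<integral>\<^sup>+r. ennreal (dim_omega TYPE('a) * r ^ (DIM('a) - 1)) *
        indicator {0..a} r \<partial>lborel)"
      by (intro nn_integral_cong) (auto split: split_indicator)
    also have "\<dots> = unit_ball_vol (real DIM('a)) * a ^ DIM('a) -
        unit_ball_vol (real DIM('a)) * 0 ^ DIM('a)"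
      using False
      by (intro nn_integral_FTC_Icc)
        (auto simp: dim_omega_unit_ball_vol intro!: derivative_eq_intros)
    finally show ?thesis using False by simp
  qed
  show "emeasure ?M X = emeasure ?N X" if "X \<in> range (\<lambda>a::real. {..a})" for X
    using that M_eq N_eq by auto
  show "Int_stable (range (\<lambda>a::real. {..a}))"
    by (auto simp: Int_stable_def)
  show "emeasure ?M {..real i} \<noteq> \<infinity>" for i using M_eq[of "real i"] by simp
  show "(\<Union>i. {..real i}) = UNIV" using real_arch_simple by auto
qed (auto simp: borel_eq_atMost)

lemma nn_integral_norm:
  fixes f :: "real \<Rightarrow> ennreal"
  assumes [measurable]: "f \<in> borel_measurable borel"
  shows "(\<integral>\<^sup>+v. f (norm v) \<partial>(lborel :: 'a::euclidean_space measure)) =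
    (\<integral>\<^sup>+r. ennreal (dim_omega TYPE('a) * r ^ (DIM('a) - 1)) * indicator {0..} r * f r \<partial>lborel)"
proof -
  have "(\<integral>\<^sup>+v. f (norm v) \<partial>(lborel :: 'a measure)) =
      (\<integral>\<^sup>+r. f r \<partial>distr (lborel :: 'a measure) borel norm)"
    by (simp add: nn_integral_distr)
  then show ?thesis
    by (simp add: distr_lborel_norm nn_integral_density)
qed

lemma powr_add_DIM:
  fixes r :: real
  assumes "0 < r"
  shows "r ^ (DIM('a::euclidean_space) - 1) / r powr (real DIM('a) + s) = r powr (- s - 1)"
proof -
  have "r ^ (DIM('a) - 1) = r powr (real DIM('a) - 1)"
    using assms by (simp add: powr_realpow[symmetric] of_nat_diff)
  then have "r ^ (DIM('a) - 1) / r powr (real DIM('a) + s) = r powr (real DIM('a) - 1 - (real DIM('a) + s))"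
    by (simp only: powr_diff)
  also have "real DIM('a) - 1 - (real DIM('a) + s) = - s - 1" by simp
  finally show ?thesis .
qed

text \<open>The radial density of the kernel is \<open>r powr (- s - 1)\<close>, with antiderivative
  \<open>- r powr (- s) / s\<close>, which vanishes at infinity because \<open>s\<close> is
  positive. This is the source of the term in \<open>1 / s\<close>.\<close>

lemma has_bochner_integral_outside_ball:
  assumes "0 < s" "0 < R"
  shows "has_bochner_integral (lborel :: 'a::euclidean_space measure)
    (\<lambda>v. indicator (- ball 0 R) v / norm v powr (real DIM('a) + s))
    (dim_omega TYPE('a) * R powr (- s) / s)"
proof (rule has_bochner_integral_nn_integral)
  let ?f = "\<lambda>r::real. ennreal (indicator {R..} r / r powr (real DIM('a) + s))"
  have "(\<integral>\<^sup>+v. ennreal (indicator (- ball 0 R) v / norm v powr (real DIM('a) + s)) \<partial>(lborel :: 'a measure))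
      = (\<integral>\<^sup>+v. ?f (norm v) \<partial>(lborel :: 'a measure))"
    by (intro nn_integral_cong) (auto split: split_indicator)
  also have "\<dots> = (\<integral>\<^sup>+r. ennreal (dim_omega TYPE('a) * r ^ (DIM('a) - 1)) * indicator {0..} r * ?f r \<partial>lborel)"
    by (intro nn_integral_norm) auto
  also have "\<dots> = (\<integral>\<^sup>+r. ennreal (dim_omega TYPE('a) * r powr (- s - 1)) * indicator {R..} r \<partial>lborel)"
  proof (intro nn_integral_cong)
    fix r :: real
    show "ennreal (dim_omega TYPE('a) * r ^ (DIM('a) - 1)) * indicator {0..} r * ?f r =
        ennreal (dim_omega TYPE('a) * r powr (- s - 1)) * indicator {R..} r"
    proof (cases "R \<le> r")
      case True
      then have "0 < r" using assms by simp
      then have "dim_omega TYPE('a) * r ^ (DIM('a) - 1) * (1 / r powr (real DIM('a) + s)) =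
          dim_omega TYPE('a) * r powr (- s - 1)"
        using powr_add_DIM[of r, where 'a = 'a and s = s] by (metis mult.assoc mult.right_neutral times_divide_eq_right)
      then have "ennreal (dim_omega TYPE('a) * r ^ (DIM('a) - 1)) * ennreal (1 / r powr (real DIM('a) + s)) =
          ennreal (dim_omega TYPE('a) * r powr (- s - 1))"
        using \<open>0 < r\<close> by (subst ennreal_mult[symmetric]) (auto simp: dim_omega_nonneg)
      then show ?thesis using True \<open>0 < r\<close> by simp
    qed simp
  qed
  also have "\<dots> = ennreal (0 - (- dim_omega TYPE('a) * R powr (- s) / s))"
  proof (rule nn_integral_FTC_atLeast)
    fix r assume "R \<le> r"
    with assms have "r > 0" by simp
    then show "((\<lambda>r. - dim_omega TYPE('a) * r powr (- s) / s) has_real_derivative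
        dim_omega TYPE('a) * r powr (- s - 1)) (at r)"
      using assms by (auto intro!: derivative_eq_intros)
    show "0 \<le> dim_omega TYPE('a) * r powr (- s - 1)" by (simp add: dim_omega_nonneg)
  next
    have "((\<lambda>r. - dim_omega TYPE('a) * r powr (- s) / s) \<longlongrightarrow> - dim_omega TYPE('a) * 0 / s) at_top"
      using assms by (intro tendsto_intros tendsto_neg_powr filterlim_ident) auto
    then show "((\<lambda>r. - dim_omega TYPE('a) * r powr (- s) / s) \<longlongrightarrow> 0) at_top" by simp
  qed simp
  finally show "(\<integral>\<^sup>+v. ennreal (indicator (- ball 0 R) v / norm v powr (real DIM('a) + s)) \<partial>(lborel :: 'a measure))
      = ennreal (dim_omega TYPE('a) * R powr (- s) / s)" by simp
qed (use assms in \<open>auto simp: dim_omega_nonneg\<close>)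

text \<open>When the exponent is exactly the dimension, the radial density is \<open>1 / t\<close>,
  and a logarithm takes the place of the power. It is what \<open>frac_curv0\<close> has to
  compensate.\<close>

lemma has_bochner_integral_annulus:
  assumes "0 < r" "r \<le> R"
  shows "has_bochner_integral (lborel :: 'a::euclidean_space measure)
    (\<lambda>v. indicator (ball 0 R - ball 0 r) v / norm v powr real DIM('a))
    (dim_omega TYPE('a) * ln (R / r))"
proof (rule has_bochner_integral_nn_integral)
  let ?f = "\<lambda>t::real. ennreal (indicator {r..<R} t / t powr real DIM('a))"
  have "(\<integral>\<^sup>+v. ennreal (indicator (ball 0 R - ball 0 r) v / norm v powr real DIM('a)) \<partial>(lborel :: 'a measure))
      = (\<integral>\<^sup>+v. ?f (norm v) \<partial>(lborel :: 'a measure))"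
    by (intro nn_integral_cong) (auto split: split_indicator)
  also have "\<dots> = (\<integral>\<^sup>+t. ennreal (dim_omega TYPE('a) * t ^ (DIM('a) - 1)) * indicator {0..} t * ?f t \<partial>lborel)"
    by (intro nn_integral_norm) auto
  also have "\<dots> = (\<integral>\<^sup>+t. ennreal (dim_omega TYPE('a) / t) * indicator {r..R} t \<partial>lborel)"
  \<comment> \<open>The open ball leaves out the sphere of radius \<open>R\<close>; one radius is a
    null set, so the interval can be closed for the fundamental theorem of calculus.\<close>
  proof (rule nn_integral_cong_AE, use AE_lborel_singleton[of R] in eventually_elim)
    fix t assume "t \<noteq> R"
    show "ennreal (dim_omega TYPE('a) * t ^ (DIM('a) - 1)) * indicator {0..} t * ?f t =
        ennreal (dim_omega TYPE('a) / t) * indicator {r..R} t"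
    proof (cases "t \<in> {r..R}")
      case True
      then have "0 < t" using assms by simp
      have "t powr (- 0 - 1) = 1 / t" using \<open>0 < t\<close> powr_minus_divide[of t 1] by simp
      then have "dim_omega TYPE('a) * t ^ (DIM('a) - 1) * (1 / t powr real DIM('a)) = dim_omega TYPE('a) / t"
        using powr_add_DIM[OF \<open>0 < t\<close>, where 'a = 'a and s = 0]
        by (metis add.right_neutral mult.assoc mult.right_neutral times_divide_eq_right)
      then have "ennreal (dim_omega TYPE('a) * t ^ (DIM('a) - 1)) * ennreal (1 / t powr real DIM('a)) =
          ennreal (dim_omega TYPE('a) / t)"
        using \<open>0 < t\<close> by (subst ennreal_mult[symmetric]) (auto simp: dim_omega_nonneg)
      then show ?thesis using True \<open>0 < t\<close> \<open>t \<noteq> R\<close> by simp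
    qed (auto split: split_indicator)
  qed
  also have "\<dots> = ennreal (dim_omega TYPE('a) * ln R - dim_omega TYPE('a) * ln r)"
    using assms
    by (intro nn_integral_FTC_Icc)
      (auto simp: dim_omega_nonneg intro!: derivative_eq_intros divide_nonneg_nonneg)
  finally show "(\<integral>\<^sup>+v. ennreal (indicator (ball 0 R - ball 0 r) v / norm v powr real DIM('a)) \<partial>(lborel :: 'a measure))
      = ennreal (dim_omega TYPE('a) * ln (R / r))"
    using assms by (simp add: ln_div right_diff_distrib)
next
  show "(\<lambda>v. indicator (ball 0 R - ball 0 r) v / norm v powr real DIM('a))
      \<in> borel_measurable (lborel :: 'a measure)"
    by (intro borel_measurable_divide borel_measurable_indicator powr_real_measurable
        borel_measurable_norm measurable_ident_sets) auto
qed (use assms in \<open>auto simp: dim_omega_nonneg\<close>)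

section \<open>Point reflections and the volume of thin slabs\<close>

lemma lborel_reflect: "distr lborel borel (\<lambda>v. x - v) = (lborel :: 'a::euclidean_space measure)"
proof -
  have "(lborel :: 'a measure) = density (distr lborel borel (\<lambda>v. x + (- 1) *\<^sub>R v)) (\<lambda>_. ennreal (\<bar>- 1\<bar> ^ DIM('a)))"
    using lborel_affine[of "-1" x] by simp
  then show ?thesis by (simp add: density_1)
qed

lemma integral_lborel_reflect:
  fixes f :: "'a::euclidean_space \<Rightarrow> real"
  assumes [measurable]: "f \<in> borel_measurable borel"
  shows "(LINT v|lborel. f (x - v)) = (LINT v|lborel. f v)"
  using integral_distr[of "\<lambda>v. x - v" lborel borel f] by (simp add: lborel_reflect)

text \<open>The volume is linear in the thickness. For a thickness of the order of the square of
  \<open>R\<close> this gains one power of \<open>R\<close> over the volume of the ball, which makes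
  up for the singularity of the kernel.\<close>

lemma measure_slab:
  fixes w :: "'a::euclidean_space"
  assumes "w \<noteq> 0" "0 < \<epsilon>" "0 \<le> R"
  shows "measure lebesgue {v \<in> ball 0 R. \<bar>w \<bullet> v\<bar> \<le> \<epsilon>} * (norm w * R) \<le>
    3 * 2 ^ DIM('a) * unit_ball_vol (real DIM('a)) * \<epsilon> * R ^ DIM('a)"
proof -
  define A where "A = {v \<in> ball 0 R. \<bar>w \<bullet> v\<bar> \<le> \<epsilon>}"
  \<comment> \<open>Consecutive translates are \<open>3 * \<epsilon>\<close> apart as measured by
    \<open>w\<close>, more than the width \<open>2 * \<epsilon>\<close> of the slab;
    \<open>N\<close> is the largest index for which the shift \<open>t j\<close> has norm at most
    \<open>R\<close>.\<close>
  define N where "N = nat \<lfloor>R * norm w / (3 * \<epsilon>)\<rfloor>"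
  define t where "t j = (3 * \<epsilon> * real j / (norm w)\<^sup>2) *\<^sub>R w" for j :: nat
  have wt: "w \<bullet> t j = 3 * \<epsilon> * real j" for j
    using assms by (simp add: t_def dot_square_norm)
  have "A \<in> sets borel" unfolding A_def by measurable
  moreover have "bounded A" unfolding A_def by (rule bounded_subset[OF bounded_ball[of 0 R]]) auto
  ultimately have A: "A \<in> lmeasurable"
    by (simp add: bounded_set_imp_lmeasurable)
  have Nle: "real j \<le> R * norm w / (3 * \<epsilon>)" if "j \<le> N" for j
  proof -
    have "real j \<le> real N" using that by simp
    also have "\<dots> \<le> R * norm w / (3 * \<epsilon>)"
      unfolding N_def using assms by simp
    finally show ?thesis .
  qed
  have nt: "norm (t j) \<le> R" if "j \<le> N" for j
  proof -
    have "norm (t j) = 3 * \<epsilon> * real j / norm w"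
      using assms by (simp add: t_def power2_eq_square)
    also have "\<dots> \<le> R" using Nle[OF that] assms by (simp add: field_simps)
    finally show ?thesis .
  qed
  txt \<open>The measure bound comes from \<open>N + 1\<close> disjoint translates of \<open>A\<close> inside \<open>ball 0 (2 * R)\<close>.\<close>
  have "disjnt ((+) (t i) ` A) ((+) (t j) ` A)" if "i \<noteq> j" for i j
  proof (rule ccontr)
    assume "\<not> ?thesis"
    then obtain a b where ab: "a \<in> A" "b \<in> A" "t i + a = t j + b" by (auto simp: disjnt_def)
    then have "w \<bullet> t i - w \<bullet> t j = w \<bullet> b - w \<bullet> a"
      by (metis add_diff_cancel_left' add_diff_eq diff_add_cancel inner_add_right inner_diff_right)
    then have "3 * \<epsilon> * (real i - real j) = w \<bullet> b - w \<bullet> a"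
      by (simp add: wt right_diff_distrib)
    then have "\<bar>3 * \<epsilon> * (real i - real j)\<bar> \<le> 2 * \<epsilon>"
      using ab assms by (auto simp: A_def)
    then have "3 * \<epsilon> * \<bar>real i - real j\<bar> \<le> 2 * \<epsilon>"
      using assms by (simp add: abs_mult)
    moreover have "1 \<le> \<bar>real i - real j\<bar>" using that by linarith
    ultimately show False using assms
      by (smt (verit) mult_less_cancel_left2 mult_le_cancel_left1)
  qed
  then have "measure lebesgue (\<Union>j\<in>{..N}. (+) (t j) ` A) = (\<Sum>j\<in>{..N}. measure lebesgue ((+) (t j) ` A))"
    by (intro measure_UNION') (auto simp: pairwise_def A measurable_translation)
  then have "real (Suc N) * measure lebesgue A = measure lebesgue (\<Union>j\<in>{..N}. (+) (t j) ` A)"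
    by (simp add: measure_translation)
  also have "\<dots> \<le> measure lebesgue (ball (0::'a) (2 * R))"
  proof (rule measure_mono_fmeasurable)
    show "(\<Union>j\<in>{..N}. (+) (t j) ` A) \<subseteq> ball 0 (2 * R)"
    proof
      fix z assume "z \<in> (\<Union>j\<in>{..N}. (+) (t j) ` A)"
      then obtain j a where "j \<le> N" "a \<in> A" "z = t j + a" by auto
      then show "z \<in> ball 0 (2 * R)"
        using nt[of j] norm_triangle_ineq[of "t j" a] by (simp add: A_def)
    qed
    show "(\<Union>j\<in>{..N}. (+) (t j) ` A) \<in> sets lebesgue"
      using A by (intro sets.finite_UN) (auto intro!: fmeasurableD measurable_translation)
  qed simp
  also have "\<dots> = unit_ball_vol (real DIM('a)) * (2 * R) ^ DIM('a)"
    using assms by (simp add: content_ball)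
  finally have "real (Suc N) * measure lebesgue A \<le> unit_ball_vol (real DIM('a)) * (2 * R) ^ DIM('a)" .
  moreover have "R * norm w / (3 * \<epsilon>) \<le> real (Suc N)"
    unfolding N_def using assms by (simp add: le_nat_floor) linarith
  then have "R * norm w / (3 * \<epsilon>) * measure lebesgue A \<le> real (Suc N) * measure lebesgue A"
    by (rule mult_right_mono) simp
  ultimately have "R * norm w / (3 * \<epsilon>) * measure lebesgue A \<le> unit_ball_vol (real DIM('a)) * (2 * R) ^ DIM('a)"
    by linarith
  then show ?thesis
    using assms unfolding A_def[symmetric] by (simp add: field_simps power_mult_distrib)
qed

section \<open>Singular integrals over annuli\<close>

text \<open>The exponent is a parameter because it moves with \<open>s\<close> and tends to the
  dimension, the exponent of the 0-curvature. The centre is the origin, so that the point reflection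
  becomes \<open>v \<mapsto> - v\<close>.\<close>

definition annulus_integral :: "real \<Rightarrow> real \<Rightarrow> real \<Rightarrow> ('a::euclidean_space \<Rightarrow> real) \<Rightarrow> real" where
  "annulus_integral p r R h =
     (LINT v|lborel. indicator (ball 0 R - ball 0 r) v * (h v / norm v powr p))"

lemma borel_measurable_annulus:
  fixes h :: "'a::euclidean_space \<Rightarrow> real"
  assumes "h \<in> borel_measurable borel"
  shows "(\<lambda>v. indicator (ball 0 R - ball 0 r) v * (h v / norm v powr p)) \<in> borel_measurable borel"
  by (intro borel_measurable_times borel_measurable_divide borel_measurable_indicator
      powr_real_measurable borel_measurable_norm assms) auto

lemma annulus_integrand_bound:
  assumes "\<bar>h v\<bar> \<le> 1" "0 < r" "0 \<le> p"
  shows "\<bar>indicator (ball 0 R - ball 0 r) v * (h v / norm v powr p)\<bar> \<le>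
    indicator (ball 0 R) v * r powr (- p)"
proof (cases "v \<in> ball 0 R - ball 0 r")
  case True
  then have "r powr p \<le> norm v powr p" using assms by (intro powr_mono2) auto
  then have "\<bar>h v\<bar> / norm v powr p \<le> 1 / r powr p"
    using assms by (intro frac_le) auto
  then show ?thesis using True by (simp add: powr_minus_divide abs_divide)
qed auto

lemma integrable_ball_const:
  "integrable lborel (\<lambda>v::'a::euclidean_space. indicator (ball 0 R) v * (c::real))"
  by (intro integrable_mult_left integrable_real_indicator)
    (use emeasure_lborel_ball_finite[of "0::'a" R] in auto)

lemma integrable_annulus:
  fixes h :: "'a::euclidean_space \<Rightarrow> real"
  assumes "h \<in> borel_measurable borel" "\<And>v. \<bar>h v\<bar> \<le> 1" "0 < r" "0 \<le> p"
  shows "integrable lborel (\<lambda>v. indicator (ball 0 R - ball 0 r) v * (h v / norm v powr p))"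
  by (rule Bochner_Integration.integrable_bound[OF integrable_ball_const[of R "r powr (- p)"]])
    (use assms annulus_integrand_bound[of h] borel_measurable_annulus in auto)

lemma annulus_integral_split:
  fixes h :: "'a::euclidean_space \<Rightarrow> real"
  assumes "h \<in> borel_measurable borel" "\<And>v. \<bar>h v\<bar> \<le> 1" "0 < r" "0 \<le> p" "r \<le> m" "m \<le> R"
  shows "annulus_integral p r R h = annulus_integral p r m h + annulus_integral p m R h"
proof -
  let ?f = "\<lambda>r R v. indicator (ball 0 R - ball 0 r) v * (h v / norm v powr p)"
  have "integrable lborel (?f r m)" "integrable lborel (?f m R)"
    using assms by (auto intro!: integrable_annulus simp only:)
  then have "(LINT v|lborel. ?f r m v + ?f m R v) = annulus_integral p r m h + annulus_integral p m R h"
    unfolding annulus_integral_def by (rule Bochner_Integration.integral_add)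
  moreover have "?f r m v + ?f m R v = ?f r R v" for v
    using assms by (auto split: split_indicator)
  ultimately show ?thesis by (simp add: annulus_integral_def)
qed

text \<open>The annulus and the kernel are invariant under \<open>v \<mapsto> - v\<close>, so the
  odd part of \<open>h\<close> integrates to zero and only the even part contributes.\<close>

lemma annulus_integral_symmetrize:
  fixes h :: "'a::euclidean_space \<Rightarrow> real"
  assumes [measurable]: "h \<in> borel_measurable borel" and h: "\<And>v. \<bar>h v\<bar> \<le> 1" "0 < r" "0 \<le> p"
  shows "annulus_integral p r R h = annulus_integral p r R (\<lambda>v. (h v + h (- v)) / 2)"
proof -
  let ?f = "\<lambda>h v. indicator (ball 0 R - ball 0 r) v * (h v / norm v powr p)"
  have "annulus_integral p r R (\<lambda>v. h (- v)) = annulus_integral p r R h"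
    using integral_lborel_reflect[OF borel_measurable_annulus[OF assms(1), of R r p], of 0]
    by (simp add: annulus_integral_def indicator_def)
  moreover have "annulus_integral p r R (\<lambda>v. (h v + h (- v)) / 2) =
      (LINT v|lborel. (?f h v + ?f (\<lambda>v. h (- v)) v) / 2)"
    unfolding annulus_integral_def
    by (intro Bochner_Integration.integral_cong) (auto split: split_indicator simp: add_divide_distrib)
  moreover have "(LINT v|lborel. (?f h v + ?f (\<lambda>v. h (- v)) v) / 2) =
      (annulus_integral p r R h + annulus_integral p r R (\<lambda>v. h (- v))) / 2"
    unfolding annulus_integral_def
    by (simp only: integral_divide_zero, subst Bochner_Integration.integral_add)
      (use h in \<open>auto simp only: intro!: integrable_annulus\<close>, measurable)
  ultimately show ?thesis by simp
qed

text \<open>In the annulus the even part of \<open>h\<close> vanishes off a slab whose volume is of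
  order \<open>R ^ (DIM('a) + 1)\<close>, while the kernel is of order
  \<open>R powr (- (DIM('a) + s))\<close>. The product is of order \<open>R powr (1 - s)\<close>, at
  most \<open>sqrt R\<close> since \<open>s \<le> 1/2\<close> and \<open>R \<le> 1\<close>.\<close>

lemma annulus_integral_dyadic_bound:
  fixes h :: "'a::euclidean_space \<Rightarrow> real"
  assumes h: "h \<in> borel_measurable borel" "\<And>v. \<bar>h v\<bar> \<le> 1"
    and odd: "\<And>v. norm v < R \<Longrightarrow> h v + h (- v) \<noteq> 0 \<Longrightarrow> \<bar>w \<bullet> v\<bar> \<le> C * (norm v)\<^sup>2"
    and "0 < c" "c \<le> norm w" "0 < C" "0 \<le> s" "s \<le> 1/2" "0 < R" "R \<le> 1" "R / 2 \<le> r"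
  shows "\<bar>annulus_integral (real DIM('a) + s) r R h\<bar> \<le>
    3 * 2 ^ DIM('a) * unit_ball_vol (real DIM('a)) * C / c * 2 ^ (DIM('a) + 1) * sqrt R"
proof -
  let ?p = "real DIM('a) + s"
  let ?h = "\<lambda>v. (h v + h (- v)) / 2"
  let ?K = "3 * 2 ^ DIM('a) * unit_ball_vol (real DIM('a))"
  define A where "A = {v \<in> ball 0 R. \<bar>w \<bullet> v\<bar> \<le> C * R\<^sup>2}"
  have "0 < r" using assms by simp
  have [measurable]: "h \<in> borel_measurable borel" by fact
  have A: "A \<in> sets borel" unfolding A_def by measurable
  have "A \<subseteq> ball 0 R" by (auto simp: A_def)
  then have "emeasure lborel A \<le> emeasure lborel (ball (0::'a) R)" by (intro emeasure_mono) auto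
  then have Afin: "emeasure lborel A < \<infinity>"
    using emeasure_lborel_ball_finite[of "0::'a" R] by (simp add: le_less_trans)
  have le1: "\<bar>?h v\<bar> \<le> 1" for v using h(2)[of v] h(2)[of "- v"] by (simp add: abs_le_iff)
  have bd: "\<bar>indicator (ball 0 R - ball 0 r) v * (?h v / norm v powr ?p)\<bar> \<le> indicator A v * r powr (- ?p)" for v
  proof (cases "v \<in> ball 0 R - ball 0 r \<and> ?h v \<noteq> 0")
    case True
    then have "\<bar>w \<bullet> v\<bar> \<le> C * (norm v)\<^sup>2" using odd[of v] by auto
    also have "\<dots> \<le> C * R\<^sup>2" using True \<open>0 < C\<close> by (intro mult_left_mono power_mono) auto
    finally have "v \<in> A" using True by (simp add: A_def)
    then show ?thesis
      using annulus_integrand_bound[of ?h v r ?p R] le1[of v] \<open>0 < r\<close> \<open>0 \<le> s\<close> True by auto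
  qed auto
  have "\<bar>annulus_integral ?p r R h\<bar> = \<bar>annulus_integral ?p r R ?h\<bar>"
    using annulus_integral_symmetrize[OF h \<open>0 < r\<close>, of ?p R] \<open>0 \<le> s\<close> by simp
  also have "\<dots> \<le> (LINT v|lborel. \<bar>indicator (ball 0 R - ball 0 r) v * (?h v / norm v powr ?p)\<bar>)"
    unfolding annulus_integral_def by (rule integral_abs_bound)
  also have "\<dots> \<le> (LINT v|lborel. indicator A v * r powr (- ?p))"
    using A Afin le1 \<open>0 < r\<close> \<open>0 \<le> s\<close>
    by (intro integral_mono integrable_abs integrable_annulus bd) auto
  also have "\<dots> = measure lborel A * r powr (- ?p)"
    using A by (simp add: integral_indicator)
  also have "\<dots> \<le> (?K * C / c * R powr (real DIM('a) + 1)) * (2 ^ (DIM('a) + 1) * R powr (- ?p))"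
  proof (rule mult_mono)
    have "measure lborel A * (norm w * R) \<le> ?K * (C * R\<^sup>2) * R ^ DIM('a)"
      using measure_slab[of w "C * R\<^sup>2" R] assms A unfolding A_def[symmetric]
      by (cases "w = 0") (auto simp: measure_completion)
    moreover have "measure lborel A * (c * R) \<le> measure lborel A * (norm w * R)"
      using assms by (intro mult_left_mono mult_right_mono) auto
    ultimately have "measure lborel A * (c * R) \<le> ?K * (C * R\<^sup>2) * R ^ DIM('a)" by linarith
    then have "measure lborel A \<le> ?K * C / c * R ^ (DIM('a) + 1)"
      using assms by (simp add: field_simps power2_eq_square)
    then show "measure lborel A \<le> ?K * C / c * R powr (real DIM('a) + 1)"
      using assms powr_realpow[of R "DIM('a) + 1"] by (simp add: add.commute)
    have "r powr (- ?p) \<le> (R / 2) powr (- ?p)"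
      using assms by (intro powr_mono2') auto
    also have "\<dots> = R powr (- ?p) / 2 powr (- ?p)"
      by (rule powr_divide)
    also have "\<dots> = 2 powr ?p * R powr (- ?p)"
      by (simp only: powr_minus[of 2] divide_inverse inverse_inverse_eq mult.commute)
    \<comment> \<open>The exponent is rounded up so that the constant does not depend on
      \<open>s\<close>.\<close>
    also have "\<dots> \<le> 2 powr (real (DIM('a) + 1)) * R powr (- ?p)"
      using assms by (intro mult_right_mono powr_mono) auto
    also have "2 powr real (DIM('a) + 1) = (2::real) ^ (DIM('a) + 1)"
      by (rule powr_realpow) simp
    finally show "r powr (- ?p) \<le> 2 ^ (DIM('a) + 1) * R powr (- ?p)" .
  qed (use assms in auto)
  also have "\<dots> = ?K * C / c * 2 ^ (DIM('a) + 1) * (R powr (real DIM('a) + 1) * R powr (- ?p))"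
    by simp
  also have "R powr (real DIM('a) + 1) * R powr (- ?p) = R powr (1 - s)"
    by (simp flip: powr_add)
  also have "?K * C / c * 2 ^ (DIM('a) + 1) * R powr (1 - s) \<le> ?K * C / c * 2 ^ (DIM('a) + 1) * R powr (1/2)"
    using assms by (intro mult_left_mono powr_mono') auto
  also have "R powr (1/2) = sqrt R" using assms by (simp add: powr_half_sqrt)
  finally show ?thesis .
qed

text \<open>The annulus is cut at \<open>R / 2\<close> repeatedly until the inner radius is reached.
  The dyadic bounds decay geometrically, so their sum is controlled by the outermost one,
  independently of \<open>r\<close>.\<close>

lemma annulus_integral_bound:
  fixes h :: "'a::euclidean_space \<Rightarrow> real"
  assumes h: "h \<in> borel_measurable borel" "\<And>v. \<bar>h v\<bar> \<le> 1"
    and odd: "\<And>v. norm v < \<rho> \<Longrightarrow> h v + h (- v) \<noteq> 0 \<Longrightarrow> \<bar>w \<bullet> v\<bar> \<le> C * (norm v)\<^sup>2"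
    and c: "0 < c" "c \<le> norm w" "0 < C" "0 \<le> s" "s \<le> 1/2" and R: "0 < r" "r \<le> R" "R \<le> 1" "R \<le> \<rho>"
  shows "\<bar>annulus_integral (real DIM('a) + s) r R h\<bar> \<le>
    4 * (3 * 2 ^ DIM('a) * unit_ball_vol (real DIM('a)) * C / c * 2 ^ (DIM('a) + 1)) * sqrt R"
proof -
  define D where "D = 3 * 2 ^ DIM('a) * unit_ball_vol (real DIM('a)) * C / c * 2 ^ (DIM('a) + 1)"
  have "0 \<le> D" using c by (simp add: D_def)
  have dyadic: "\<bar>annulus_integral (real DIM('a) + s) r R h\<bar> \<le> D * sqrt R"
    if "0 < R" "R \<le> 1" "R \<le> \<rho>" "R / 2 \<le> r" for r R
    unfolding D_def using that by (intro annulus_integral_dyadic_bound[where w = w] h c odd) auto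
  \<comment> \<open>\<open>N\<close> bounds the number of halvings that lead from \<open>R\<close>
    down to \<open>r\<close>. The constant is stable in the induction because
    \<open>4 * (3/4) + 1 = 4\<close>.\<close>
  have *: "\<bar>annulus_integral (real DIM('a) + s) r R h\<bar> \<le> 4 * D * sqrt R"
    if "R / 2 ^ N \<le> r" "0 < r" "r \<le> R" "R \<le> 1" "R \<le> \<rho>" for r R N
    using that
  proof (induction N arbitrary: R)
    case 0
    then show ?case using dyadic[of R r] mult_right_mono[OF \<open>0 \<le> D\<close>, of "sqrt R"] by simp
  next
    case (Suc N)
    show ?case
    proof (cases "R / 2 \<le> r")
      case True
      then show ?thesis
        using Suc.prems dyadic[of R r] mult_right_mono[OF \<open>0 \<le> D\<close>, of "sqrt R"] by simp
    next
      case False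
      \<comment> \<open>The rational \<open>3/4\<close> replaces the factor
        \<open>1 / sqrt 2\<close>; its square \<open>9/16\<close> exceeds
        \<open>1/2\<close>.\<close>
      have "sqrt (R / 2) \<le> sqrt ((3/4)\<^sup>2 * R)"
        using Suc.prems by (intro real_sqrt_le_mono) (simp add: power2_eq_square)
      also have "\<dots> = 3/4 * sqrt R" by (simp add: real_sqrt_mult)
      finally have "4 * D * sqrt (R / 2) \<le> 4 * D * (3/4 * sqrt R)"
        using \<open>0 \<le> D\<close> by (intro mult_left_mono) auto
      moreover have "\<bar>annulus_integral (real DIM('a) + s) r (R / 2) h\<bar> \<le> 4 * D * sqrt (R / 2)"
        using Suc.prems False by (intro Suc.IH) auto
      moreover have "\<bar>annulus_integral (real DIM('a) + s) (R / 2) R h\<bar> \<le> D * sqrt R"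
        using Suc.prems by (intro dyadic) auto
      moreover have "annulus_integral (real DIM('a) + s) r R h =
          annulus_integral (real DIM('a) + s) r (R / 2) h + annulus_integral (real DIM('a) + s) (R / 2) R h"
        using Suc.prems False c by (intro annulus_integral_split h) auto
      ultimately show ?thesis by linarith
    qed
  qed
  obtain N where "R / r < 2 ^ N" using real_arch_pow[of 2 "R / r"] by auto
  then have "R / 2 ^ N \<le> r" using R by (simp add: field_simps)
  from *[OF this] R show ?thesis unfolding D_def by simp
qed

section \<open>Limits in the inner radius and along the sequence\<close>

text \<open>The assumed bound is a Cauchy criterion as the radius shrinks. The rate is returned
  together with the limit: a rate shared by all members of a sequence is what later allows two
  limits to be exchanged.\<close>

lemma tendsto_at_right_0_of_sqrt_bound:
  fixes F :: "real \<Rightarrow> real"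
  assumes "0 < \<rho>" and F: "\<And>r R. 0 < r \<Longrightarrow> r \<le> R \<Longrightarrow> R \<le> \<rho> \<Longrightarrow> \<bar>F r - F R\<bar> \<le> K * sqrt R"
  obtains L where "(F \<longlongrightarrow> L) (at_right 0)" "\<And>r. 0 < r \<Longrightarrow> r \<le> \<rho> \<Longrightarrow> \<bar>F r - L\<bar> \<le> K * sqrt r"
proof -
  \<comment> \<open>A sequence of radii decreasing to zero supplies a candidate limit by
    completeness; the rate then gives convergence along all radii.\<close>
  define q where "q k = \<rho> / real (Suc k)" for k
  have q: "0 < q k" "q k \<le> \<rho>" for k
    using \<open>0 < \<rho>\<close> by (auto simp: q_def field_simps)
  have q0: "q \<longlonglongrightarrow> 0"
    unfolding q_def using tendsto_mult_right[OF LIMSEQ_inverse_real_of_nat, of \<rho>]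
    by (simp add: divide_inverse mult.commute)
  have small: "(\<lambda>k. K * sqrt (q k)) \<longlonglongrightarrow> 0"
    using tendsto_mult_left[OF tendsto_real_sqrt[OF q0], of K] by simp
  have q_mono: "q m \<le> q k" if "k \<le> m" for k m
    unfolding q_def using that \<open>0 < \<rho>\<close> by (intro divide_left_mono) auto
  have "Cauchy (\<lambda>k. F (q k))"
  proof (rule metric_CauchyI)
    fix e :: real assume "0 < e"
    with small obtain k where k: "\<bar>K * sqrt (q k)\<bar> < e / 2"
      by (metis LIMSEQ_D half_gt_zero order_refl diff_zero real_norm_def)
    have "dist (F (q m)) (F (q k)) < e / 2" if "k \<le> m" for m
      using F[OF q(1) q_mono[OF that] q(2)] k by (simp add: dist_real_def)
    then show "\<exists>M. \<forall>m\<ge>M. \<forall>n\<ge>M. dist (F (q m)) (F (q n)) < e"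
      by (meson dist_triangle_half_l)
  qed
  then obtain L where L: "(\<lambda>k. F (q k)) \<longlonglongrightarrow> L"
    using Cauchy_convergent convergent_def by blast
  have bound: "\<bar>F r - L\<bar> \<le> K * sqrt r" if "0 < r" "r \<le> \<rho>" for r
  proof (rule tendsto_upperbound)
    show "(\<lambda>k. \<bar>F r - F (q k)\<bar>) \<longlonglongrightarrow> \<bar>F r - L\<bar>" by (intro tendsto_intros L)
    have "\<forall>\<^sub>F k in sequentially. q k < r" using order_tendstoD(2)[OF q0 that(1)] .
    then show "\<forall>\<^sub>F k in sequentially. \<bar>F r - F (q k)\<bar> \<le> K * sqrt r"
    proof eventually_elim
      case (elim k)
      then show ?case using F[OF q(1), of k r] that by (simp add: abs_minus_commute)
    qed
  qed simp
  have "((\<lambda>r. K * sqrt r) \<longlongrightarrow> K * sqrt 0) (at_right 0)"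
    by (intro tendsto_intros)
  moreover have "\<forall>\<^sub>F r in at_right 0. norm (F r - L) \<le> K * sqrt r"
    using \<open>0 < \<rho>\<close> bound by (intro eventually_at_rightI[of 0 \<rho>]) auto
  ultimately have "((\<lambda>r. F r - L) \<longlongrightarrow> 0) (at_right 0)"
    by (simp add: Lim_null_comparison)
  then have "(F \<longlongrightarrow> L) (at_right 0)" by (simp add: LIM_zero_iff)
  with bound that show ?thesis by blast
qed

text \<open>At a fixed positive inner radius the kernel has no singularity, so dominated convergence
  applies although the exponents vary as well.\<close>

lemma annulus_integral_tendsto:
  fixes h :: "'a::euclidean_space \<Rightarrow> real" and hn :: "nat \<Rightarrow> 'a \<Rightarrow> real"
  assumes hn: "\<And>n. hn n \<in> borel_measurable borel" "\<And>n v. \<bar>hn n v\<bar> \<le> 1"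
    and h: "h \<in> borel_measurable borel"
    and lim: "AE v in lborel. (\<lambda>n. hn n v) \<longlonglongrightarrow> h v"
    and p: "\<And>n. 0 \<le> p n" "p \<longlonglongrightarrow> q" and "0 < r"
  shows "(\<lambda>n. annulus_integral (p n) r R (hn n)) \<longlonglongrightarrow> annulus_integral q r R h"
proof -
  obtain B where B: "\<And>n. p n \<le> B" "0 \<le> B"
    using convergent_imp_Bseq[OF convergentI[OF p(2)]]
    by (metis Bseq_def abs_le_D1 less_imp_le real_norm_def)
  have "0 \<le> q" using p by (meson LIMSEQ_le_const)
  show ?thesis
    unfolding annulus_integral_def
  \<comment> \<open>\<open>B\<close> bounds all exponents. Replacing \<open>r\<close> by
    \<open>min r 1\<close> makes the power monotone in the exponent, so that one constant serves for
    \<open>r\<close> below and above 1.\<close>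
  proof (rule integral_dominated_convergence[where w = "\<lambda>v. indicator (ball 0 R) v * min r 1 powr (- B)"])
    show "AE v in lborel. (\<lambda>n. indicator (ball 0 R - ball 0 r) v * (hn n v / norm v powr p n))
        \<longlonglongrightarrow> indicator (ball 0 R - ball 0 r) v * (h v / norm v powr q)"
      using lim
    proof eventually_elim
      case (elim v)
      show ?case
      proof (cases "v \<in> ball 0 R - ball 0 r")
        case True
        then have "norm v > 0" using \<open>0 < r\<close> by auto
        then show ?thesis by (intro tendsto_intros elim p) auto
      qed simp
    qed
    show "AE v in lborel. norm (indicator (ball 0 R - ball 0 r) v * (hn n v / norm v powr p n))
        \<le> indicator (ball 0 R) v * min r 1 powr (- B)" for n
    proof (rule AE_I2)
      fix v :: 'a
      have "r powr (- p n) \<le> min r 1 powr (- p n)"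
        using p(1)[of n] \<open>0 < r\<close> by (intro powr_mono2') auto
      also have "\<dots> \<le> min r 1 powr (- B)"
        using B(1)[of n] \<open>0 < r\<close> by (intro powr_mono') auto
      finally have "indicator (ball 0 R) v * r powr (- p n) \<le> indicator (ball 0 R) v * min r 1 powr (- B)"
        by (intro mult_left_mono) auto
      then show "norm (indicator (ball 0 R - ball 0 r) v * (hn n v / norm v powr p n))
        \<le> indicator (ball 0 R) v * min r 1 powr (- B)"
        using annulus_integrand_bound[of "hn n" v r "p n" R] hn(2) p(1) \<open>0 < r\<close> by fastforce
    qed
  qed (simp_all only: measurable_lborel2 borel_measurable_annulus integrable_ball_const hn h)
qed

text \<open>The bound \<open>K * sqrt m\<close> is uniform in large \<open>n\<close> and passes to
  \<open>h\<close> at fixed radii, so all the limits \<open>r \<rightarrow> 0\<close> are approached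
  at the same rate. Comparing at one small radius, with three errors below \<open>e / 3\<close>,
  then gives convergence of \<open>Ln\<close>.\<close>

lemma annulus_integral_limits:
  fixes h :: "'a::euclidean_space \<Rightarrow> real" and hn :: "nat \<Rightarrow> 'a \<Rightarrow> real"
  assumes hn: "\<And>n. hn n \<in> borel_measurable borel" "\<And>n v. \<bar>hn n v\<bar> \<le> 1"
    and h: "h \<in> borel_measurable borel" "\<And>v. \<bar>h v\<bar> \<le> 1"
    and lim: "AE v in lborel. (\<lambda>n. hn n v) \<longlonglongrightarrow> h v"
    and p: "\<And>n. 0 \<le> p n" "p \<longlonglongrightarrow> q" and "0 < \<rho>" "\<rho> \<le> R"
    and bound: "\<forall>\<^sub>F n in sequentially. \<forall>r m. 0 < r \<longrightarrow> r \<le> m \<longrightarrow> m \<le> \<rho> \<longrightarrow>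
      \<bar>annulus_integral (p n) r m (hn n)\<bar> \<le> K * sqrt m"
  obtains L Ln where
    "((\<lambda>r. annulus_integral q r R h) \<longlongrightarrow> L) (at_right 0)"
    "\<forall>\<^sub>F n in sequentially. ((\<lambda>r. annulus_integral (p n) r R (hn n)) \<longlongrightarrow> Ln n) (at_right 0)"
    "Ln \<longlonglongrightarrow> L"
proof -
  have "0 \<le> q" using p by (meson LIMSEQ_le_const)
  have lims: "\<exists>L. ((\<lambda>r. annulus_integral t r R g) \<longlongrightarrow> L) (at_right 0) \<and>
      (\<forall>r. 0 < r \<longrightarrow> r \<le> \<rho> \<longrightarrow> \<bar>annulus_integral t r R g - L\<bar> \<le> K * sqrt r)"
    if g: "g \<in> borel_measurable borel" "\<And>v. \<bar>g v\<bar> \<le> 1" "0 \<le> t"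
      and b: "\<And>r m. 0 < r \<Longrightarrow> r \<le> m \<Longrightarrow> m \<le> \<rho> \<Longrightarrow> \<bar>annulus_integral t r m g\<bar> \<le> K * sqrt m"
    for t and g :: "'a \<Rightarrow> real"
  proof -
    have "\<bar>annulus_integral t r R g - annulus_integral t m R g\<bar> \<le> K * sqrt m"
      if "0 < r" "r \<le> m" "m \<le> \<rho>" for r m
      using b[OF that] annulus_integral_split[OF g(1,2) that(1) g(3) that(2), of R] that \<open>\<rho> \<le> R\<close> by simp
    from tendsto_at_right_0_of_sqrt_bound[OF \<open>0 < \<rho>\<close> this] show ?thesis by metis
  qed
  have "\<bar>annulus_integral q r m h\<bar> \<le> K * sqrt m" if "0 < r" "r \<le> m" "m \<le> \<rho>" for r m
  proof (rule tendsto_upperbound)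
    show "(\<lambda>n. \<bar>annulus_integral (p n) r m (hn n)\<bar>) \<longlonglongrightarrow> \<bar>annulus_integral q r m h\<bar>"
      by (intro tendsto_rabs annulus_integral_tendsto hn h lim p that)
    show "\<forall>\<^sub>F n in sequentially. \<bar>annulus_integral (p n) r m (hn n)\<bar> \<le> K * sqrt m"
      using bound by eventually_elim (use that in auto)
  qed simp
  from lims[OF h \<open>0 \<le> q\<close> this] obtain L where
    L: "((\<lambda>r. annulus_integral q r R h) \<longlongrightarrow> L) (at_right 0)"
      "\<And>r. 0 < r \<Longrightarrow> r \<le> \<rho> \<Longrightarrow> \<bar>annulus_integral q r R h - L\<bar> \<le> K * sqrt r" by auto
  \<comment> \<open>The limits are known to exist only for large \<open>n\<close>, so they are
    selected by \<open>SOME\<close>; the predicate includes the rate so that the selected value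
    comes with it.\<close>
  define P where "P n l \<longleftrightarrow> ((\<lambda>r. annulus_integral (p n) r R (hn n)) \<longlongrightarrow> l) (at_right 0) \<and>
      (\<forall>r. 0 < r \<longrightarrow> r \<le> \<rho> \<longrightarrow> \<bar>annulus_integral (p n) r R (hn n) - l\<bar> \<le> K * sqrt r)" for n l
  define Ln where "Ln n = (SOME l. P n l)" for n
  have Ln: "\<forall>\<^sub>F n in sequentially. P n (Ln n)"
    using bound
  proof eventually_elim
    case (elim n)
    then have "\<exists>l. P n l" unfolding P_def using lims[OF hn p(1)] by blast
    then show ?case unfolding Ln_def by (rule someI_ex)
  qed
  have "Ln \<longlonglongrightarrow> L"
  proof (rule tendstoI)
    fix e :: real assume "0 < e"
    have "((\<lambda>r. K * sqrt r) \<longlongrightarrow> K * sqrt 0) (at_right 0)" by (intro tendsto_intros)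
    then have "\<forall>\<^sub>F r in at_right 0. K * sqrt r < e / 3"
      using \<open>0 < e\<close> by (intro order_tendstoD(2)) auto
    moreover have "\<forall>\<^sub>F r in at_right (0::real). 0 < r \<and> r \<le> \<rho>"
      using \<open>0 < \<rho>\<close> by (intro eventually_at_rightI[of 0 \<rho>]) auto
    ultimately obtain r where r: "K * sqrt r < e / 3" "0 < r" "r \<le> \<rho>"
      using eventually_happens[OF eventually_conj] trivial_limit_at_right_real by blast
    have "(\<lambda>n. annulus_integral (p n) r R (hn n)) \<longlonglongrightarrow> annulus_integral q r R h"
      by (intro annulus_integral_tendsto hn h lim p r)
    then have "\<forall>\<^sub>F n in sequentially. dist (annulus_integral (p n) r R (hn n)) (annulus_integral q r R h) < e / 3"
      using \<open>0 < e\<close> by (intro tendstoD) auto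
    with Ln show "\<forall>\<^sub>F n in sequentially. dist (Ln n) L < e"
    proof eventually_elim
      case (elim n)
      then have "\<bar>annulus_integral (p n) r R (hn n) - Ln n\<bar> \<le> K * sqrt r"
        using r by (auto simp: P_def)
      with elim(2) L(2)[OF r(2,3)] r(1) show ?case unfolding dist_real_def by linarith
    qed
  qed
  moreover have "\<forall>\<^sub>F n in sequentially. ((\<lambda>r. annulus_integral (p n) r R (hn n)) \<longlongrightarrow> Ln n) (at_right 0)"
    using Ln by eventually_elim (simp add: P_def)
  ultimately show ?thesis using L(1) that by blast
qed

section \<open>Boundaries of class C2\<close>

lemma iter_partial_le_holder_norm:
  fixes f :: "'a::euclidean_space \<Rightarrow> 'b::real_normed_vector"
  assumes "set I \<subseteq> Basis" "length I \<le> l"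
  shows "ennreal (norm (iter_partial I f x)) \<le> holder_norm l \<beta> f"
proof -
  let ?J = "{I. set I \<subseteq> (Basis :: 'a set) \<and> length I \<le> l}"
  have "ennreal (norm (iter_partial I f x)) \<le> (SUP x. ennreal (norm (iter_partial I f x)))"
    by (rule SUP_upper) simp
  also have "\<dots> \<le> (\<Sum>I\<in>?J. SUP x. ennreal (norm (iter_partial I f x)))"
    using assms by (intro member_le_sum finite_lists_length_le) auto
  also have "\<dots> \<le> holder_norm l \<beta> f" by (simp add: holder_norm_def)
  finally show ?thesis .
qed

lemma Ck_differentiable:
  assumes "Ck l f" "l \<ge> 1"
  shows "f differentiable (at x)"
  using assms by (cases l) auto

lemma Ck_derivative_differentiable:
  assumes "Ck l f" "l \<ge> 2"
  shows "(\<lambda>x. frechet_derivative f (at x) v) differentiable (at x)"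
proof -
  obtain k where "l = Suc (Suc k)" using assms(2) by (metis Suc_le_D numeral_2_eq_2 Suc_le_mono)
  with assms show ?thesis by auto
qed

lemma Ck_continuous_on:
  assumes "Ck l f" "l \<ge> 1"
  shows "continuous_on S f"
  using Ck_differentiable[OF assms]
  by (meson continuous_at_imp_continuous_on differentiable_imp_continuous_within)

lemma linear_norm_le_Basis:
  fixes L :: "'a::euclidean_space \<Rightarrow> 'b::real_normed_vector"
  assumes "linear L" "\<And>b. b \<in> Basis \<Longrightarrow> norm (L b) \<le> M"
  shows "norm (L v) \<le> real DIM('a) * M * norm v"
proof -
  have "L v = L (\<Sum>b\<in>Basis. (v \<bullet> b) *\<^sub>R b)" by (simp add: euclidean_representation)
  also have "\<dots> = (\<Sum>b\<in>Basis. (v \<bullet> b) *\<^sub>R L b)"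
    using assms(1) by (simp add: linear_sum linear_cmul)
  also have "norm \<dots> \<le> (\<Sum>b\<in>(Basis::'a set). norm v * M)"
    by (intro sum_norm_le) (auto intro!: mult_mono assms Basis_le_norm)
  finally show ?thesis by (simp add: mult_ac)
qed

lemma lipschitz_of_partial_bound:
  fixes f :: "'a::euclidean_space \<Rightarrow> 'b::real_normed_vector"
  assumes "\<And>x. f differentiable (at x)"
    and "\<And>b x. b \<in> Basis \<Longrightarrow> norm (frechet_derivative f (at x) b) \<le> M"
  shows "norm (f y - f x) \<le> real DIM('a) * M * norm (y - x)"
proof (rule differentiable_bound[OF convex_UNIV])
  fix z
  have D: "(f has_derivative frechet_derivative f (at z)) (at z)"
    using assms(1) frechet_derivative_works by blast
  then show "(f has_derivative frechet_derivative f (at z)) (at z within UNIV)" by simp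
  show "onorm (frechet_derivative f (at z)) \<le> real DIM('a) * M"
    using linear_norm_le_Basis[OF has_derivative_linear[OF D] assms(2)]
    by (intro onorm_le)
qed auto

text \<open>The second partials make the derivative Lipschitz, and the mean value inequality on the
  segment is applied to \<open>f\<close> minus its linear part at \<open>x\<close>. A factor of the
  dimension is lost each time basis vectors are replaced by arbitrary ones, hence the
  square.\<close>

lemma C2_Taylor:
  fixes f :: "'a::euclidean_space \<Rightarrow> 'b::real_normed_vector"
  assumes f: "\<And>x. f differentiable (at x)"
    and f': "\<And>v x. (\<lambda>x. frechet_derivative f (at x) v) differentiable (at x)"
    and M: "\<And>b c x. b \<in> Basis \<Longrightarrow> c \<in> Basis \<Longrightarrow> norm (iter_partial [b, c] f x) \<le> M"
  shows "norm (f y - f x - frechet_derivative f (at x) (y - x)) \<le>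
    (real DIM('a))\<^sup>2 * M * (norm (y - x))\<^sup>2"
proof -
  let ?D = "\<lambda>z. frechet_derivative f (at z)"
  let ?B = "(real DIM('a))\<^sup>2 * M * norm (y - x)"
  have "0 \<le> M" using M[OF SOME_Basis SOME_Basis] norm_ge_zero order_trans by blast
  have D: "(f has_derivative ?D z) (at z)" for z
    using f frechet_derivative_works by blast
  then have lin: "linear (?D z)" for z by (rule has_derivative_linear)
  have "norm (?D z b - ?D x b) \<le> real DIM('a) * M * norm (z - x)" if "b \<in> Basis" for z b
    using M that f' by (intro lipschitz_of_partial_bound) auto
  then have lip: "norm (?D z v - ?D x v) \<le> (real DIM('a))\<^sup>2 * M * norm (z - x) * norm v" for z v :: 'a
    using linear_norm_le_Basis[of "\<lambda>v. ?D z v - ?D x v" "real DIM('a) * M * norm (z - x)" v] lin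
    by (simp add: linear_compose_sub power2_eq_square mult_ac)
  have "norm ((f y - ?D x y) - (f x - ?D x x)) \<le> ?B * norm (y - x)"
  proof (rule differentiable_bound[OF convex_closed_segment[of x y]])
    fix z assume z: "z \<in> closed_segment x y"
    have "((\<lambda>z. f z - ?D x z) has_derivative (\<lambda>v. ?D z v - ?D x v)) (at z)"
      by (intro has_derivative_diff D linear_imp_has_derivative lin)
    then show "((\<lambda>z. f z - ?D x z) has_derivative (\<lambda>v. ?D z v - ?D x v)) (at z within closed_segment x y)"
      by (rule has_derivative_at_withinI)
    show "onorm (\<lambda>v. ?D z v - ?D x v) \<le> ?B"
    proof (rule onorm_le)
      fix v :: 'a
      have "norm (z - x) \<le> norm (y - x)"
        using z segment_bound1 by blast
      then have "(real DIM('a))\<^sup>2 * M * norm (z - x) * norm v \<le> ?B * norm v"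
        using \<open>0 \<le> M\<close> by (intro mult_right_mono mult_left_mono) auto
      with lip[of z v] show "norm (?D z v - ?D x v) \<le> ?B * norm v" by linarith
    qed
  qed auto
  moreover have "f y - f x - ?D x (y - x) = (f y - ?D x y) - (f x - ?D x x)"
    using lin by (simp add: linear_diff)
  ultimately have "norm (f y - f x - ?D x (y - x)) \<le> ?B * norm (y - x)" by (simp only:)
  then show ?thesis by (simp add: power2_eq_square mult_ac)
qed

text \<open>The vector \<open>w\<close> represents the differential of \<open>F \<circ> \<Phi>\<^sup>-\<^sup>1\<close> at \<open>\<Phi> z0\<close>; only first order
  information on \<open>\<Phi>\<^sup>-\<^sup>1\<close> is needed.\<close>

lemma quadratic_approx_of_image:
  fixes \<Phi> :: "'a::euclidean_space \<Rightarrow> 'a" and F :: "'a \<Rightarrow> real"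
  assumes lip: "\<And>z. norm ((\<Phi> z - z) - (\<Phi> z0 - z0)) \<le> norm (z - z0) / 2"
    and A: "linear A" "\<And>v. norm (A v - v) \<le> norm v / 2"
    and \<Phi>: "\<And>z. norm (\<Phi> z - \<Phi> z0 - A (z - z0)) \<le> M * (norm (z - z0))\<^sup>2"
    and D: "linear D" "\<And>v. \<bar>D v\<bar> \<le> B * norm v" "D \<nu> = 1" "norm \<nu> = 1"
    and F: "\<And>z. \<bar>F z - D (z - z0)\<bar> \<le> K * (norm (z - z0))\<^sup>2"
    and nonneg: "0 \<le> M" "0 \<le> B" "0 \<le> K"
  obtains w where "2/3 \<le> norm w"
    "\<And>z. \<bar>F z - w \<bullet> (\<Phi> z - \<Phi> z0)\<bar> \<le> (8 * B * M + 4 * K) * (norm (\<Phi> z - \<Phi> z0))\<^sup>2"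
proof -
  \<comment> \<open>\<open>A\<close> is within 1/2 of the identity; the two bounds make it
    invertible and control both \<open>A\<close> and its inverse \<open>G\<close>.\<close>
  have Alow: "norm v \<le> 2 * norm (A v)" and Aup: "norm (A v) \<le> 3/2 * norm v" for v
    using A(2)[of v] norm_triangle_ineq3[of "A v" v] by (auto simp: abs_le_iff)
  have "inj A"
  proof (rule injI)
    fix a b assume "A a = A b"
    then have "A (a - b) = 0" using A(1) by (simp add: linear_diff)
    with Alow[of "a - b"] show "a = b" by simp
  qed
  with A(1) obtain G where G: "linear G" "\<And>v. G (A v) = v" "\<And>v. A (G v) = v"
    using linear_injective_isomorphism by blast
  have linDG: "linear (\<lambda>v. D (G v))" using linear_compose[OF G(1) D(1)] by (simp add: o_def)
  \<comment> \<open>The adjoint applied to 1 is the Riesz representative of the functional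
    \<open>\<lambda>v. D (G v)\<close>.\<close>
  define w where "w = adjoint (\<lambda>v. D (G v)) 1"
  have w: "w \<bullet> v = D (G v)" for v
    using adjoint_works[OF linDG, of v 1] by (simp add: w_def inner_commute)
  \<comment> \<open>Testing on the image of \<open>\<nu>\<close>, where the functional is 1, keeps
    \<open>w\<close> away from zero with a constant that does not depend on
    \<open>\<Phi>\<close>.\<close>
  have "1 = w \<bullet> A \<nu>" by (simp add: w G D)
  also have "\<dots> \<le> norm w * norm (A \<nu>)" by (rule norm_cauchy_schwarz)
  also have "\<dots> \<le> norm w * (3/2)" using Aup[of \<nu>] D(4) by (intro mult_left_mono) auto
  finally have "2/3 \<le> norm w" by simp
  moreover have "\<bar>F z - w \<bullet> (\<Phi> z - \<Phi> z0)\<bar> \<le> (8 * B * M + 4 * K) * (norm (\<Phi> z - \<Phi> z0))\<^sup>2" for z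
  proof -
    define e where "e = \<Phi> z - \<Phi> z0 - A (z - z0)"
    \<comment> \<open>The displacement has Lipschitz constant 1/2, so the inverse at most doubles
      distances to the base point. Squaring gives the factor 4 that turns
      \<open>2 * B * M + K\<close> into the final constant.\<close>
    have "norm (z - z0) \<le> 2 * norm (\<Phi> z - \<Phi> z0)"
      using lip[of z] norm_triangle_ineq2[of "z - z0" "\<Phi> z - \<Phi> z0"]
      by (simp add: algebra_simps norm_minus_commute)
    then have sq: "(norm (z - z0))\<^sup>2 \<le> 4 * (norm (\<Phi> z - \<Phi> z0))\<^sup>2"
      using power_mono[of "norm (z - z0)" "2 * norm (\<Phi> z - \<Phi> z0)" 2] by (simp add: power_mult_distrib)
    have "\<Phi> z - \<Phi> z0 = A (z - z0) + e" by (simp add: e_def)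
    then have "w \<bullet> (\<Phi> z - \<Phi> z0) = D (z - z0) + D (G e)"
      using G D(1) by (simp add: w linear_add)
    moreover have "\<bar>D (G e)\<bar> \<le> B * (2 * norm e)"
      using D(2)[of "G e"] Alow[of "G e"] nonneg G(3)
      by (metis mult_left_mono order_trans)
    moreover have "B * (2 * norm e) \<le> B * (2 * (M * (norm (z - z0))\<^sup>2))"
      using \<Phi>[of z] nonneg unfolding e_def by (intro mult_left_mono) auto
    ultimately have "\<bar>F z - w \<bullet> (\<Phi> z - \<Phi> z0)\<bar> \<le> (2 * B * M + K) * (norm (z - z0))\<^sup>2"
      using F[of z] by (simp add: algebra_simps)
    also have "\<dots> \<le> (2 * B * M + K) * (4 * (norm (\<Phi> z - \<Phi> z0))\<^sup>2)"
      using nonneg by (intro mult_left_mono sq) auto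
    finally show ?thesis by (simp add: algebra_simps)
  qed
  ultimately show ?thesis by (rule that)
qed

section \<open>Local defining functions and null boundaries\<close>

lemma class_C_closed: "E \<in> class_C l \<beta> \<Longrightarrow> closed E"
  by (auto simp: class_C_def)

text \<open>The graph is contained in the image of a hyperplane, a null set, under the
  differentiable map \<open>y \<mapsto> y + \<gamma> y *\<^sub>R \<nu>\<close>, and such maps of the
  space into itself preserve null sets.\<close>

lemma negligible_graph:
  fixes \<gamma> :: "'a::euclidean_space \<Rightarrow> real"
  assumes "norm \<nu> = 1" "\<And>x. \<gamma> differentiable (at x)"
  shows "negligible {z. z \<bullet> \<nu> = \<gamma> (z - (z \<bullet> \<nu>) *\<^sub>R \<nu>)}"
proof -
  let ?H = "{y. \<nu> \<bullet> y = 0}"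
  let ?f = "\<lambda>y. y + \<gamma> y *\<^sub>R \<nu>"
  have "\<nu> \<noteq> 0" using assms(1) by auto
  then have "negligible ?H" by (intro negligible_hyperplane) auto
  moreover have "?f differentiable_on ?H"
    using assms(2) unfolding differentiable_on_def
    by (auto intro!: derivative_intros intro: differentiable_at_withinI)
  ultimately have "negligible (?f ` ?H)"
    by (rule negligible_differentiable_image_negligible[OF order_refl])
  moreover have "{z. z \<bullet> \<nu> = \<gamma> (z - (z \<bullet> \<nu>) *\<^sub>R \<nu>)} \<subseteq> ?f ` ?H"
  proof
    fix z assume "z \<in> {z. z \<bullet> \<nu> = \<gamma> (z - (z \<bullet> \<nu>) *\<^sub>R \<nu>)}"
    then have z: "\<gamma> (z - (z \<bullet> \<nu>) *\<^sub>R \<nu>) = z \<bullet> \<nu>" by simp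
    show "z \<in> ?f ` ?H"
    proof (rule image_eqI)
      show "z = ?f (z - (z \<bullet> \<nu>) *\<^sub>R \<nu>)" by (simp add: z)
      have "\<nu> \<bullet> \<nu> = 1" using assms(1) by (simp add: dot_square_norm)
      then show "z - (z \<bullet> \<nu>) *\<^sub>R \<nu> \<in> ?H" by (simp add: inner_diff_right inner_commute)
    qed
  qed
  ultimately show ?thesis by (rule negligible_subset)
qed

text \<open>\<open>F\<close> is the height above the graph in the direction \<open>\<nu>\<close>,
  and \<open>D z0\<close> is its differential at \<open>z0\<close>. The Taylor estimate is uniform
  in the base point, because the point that a diffeomorphism sends to \<open>x\<close> varies with
  the diffeomorphism.\<close>

lemma class_C_defining_function:
  fixes E :: "'a::euclidean_space set"
  assumes "l \<ge> 2" "E \<in> class_C l \<beta>" "x \<in> frontier E"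
  obtains \<rho> \<nu> F D B K where "0 < \<rho>" "norm \<nu> = 1" "0 \<le> B" "0 \<le> K"
    "\<And>z. z \<in> ball x \<rho> \<Longrightarrow> z \<in> E \<Longrightarrow> 0 \<le> F z" "\<And>z. z \<in> ball x \<rho> \<Longrightarrow> z \<notin> E \<Longrightarrow> F z \<le> 0"
    "\<And>z. z \<in> ball x \<rho> \<Longrightarrow> z \<in> frontier E \<Longrightarrow> F z = 0"
    "\<And>z0. linear (D z0)" "\<And>z0. D z0 \<nu> = 1" "\<And>z0 v. \<bar>D z0 v\<bar> \<le> B * norm v"
    "\<And>z0 z. \<bar>F z - F z0 - D z0 (z - z0)\<bar> \<le> K * (norm (z - z0))\<^sup>2"
    "negligible {z. F z = (0::real)}"
proof -
  from assms(2) obtain U where U: "open U" "holder_boundary l \<beta> U" "E = closure U"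
    by (auto simp: class_C_def)
  \<comment> \<open>Taking the closure can only shrink the frontier, so the graph description of
    \<open>U\<close> is available at \<open>x\<close>.\<close>
  have "x \<in> frontier U"
    using assms(3) U(3) interior_mono[OF closure_subset[of U]] by (auto simp: frontier_def)
  with U(2) have "\<exists>\<rho>>0. \<exists>\<nu>. \<exists>\<gamma> :: 'a \<Rightarrow> real.
      norm \<nu> = 1 \<and> Ck l \<gamma> \<and> holder_norm l \<beta> \<gamma> < \<infinity> \<and>
      U \<inter> ball x \<rho> = {y \<in> ball x \<rho>. \<gamma> (y - (y \<bullet> \<nu>) *\<^sub>R \<nu>) < y \<bullet> \<nu>}"
    unfolding holder_boundary_def by (rule bspec)
  then obtain \<rho> \<nu> and \<gamma> :: "'a \<Rightarrow> real" where \<rho>: "0 < \<rho>" and \<nu>: "norm \<nu> = 1"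
    and \<gamma>: "Ck l \<gamma>" "holder_norm l \<beta> \<gamma> < \<infinity>"
    and graph: "U \<inter> ball x \<rho> = {y \<in> ball x \<rho>. \<gamma> (y - (y \<bullet> \<nu>) *\<^sub>R \<nu>) < y \<bullet> \<nu>}"
    by blast
  define P where "P z = z - (z \<bullet> \<nu>) *\<^sub>R \<nu>" for z
  define F where "F z = z \<bullet> \<nu> - \<gamma> (P z)" for z
  define D where "D z0 v = v \<bullet> \<nu> - frechet_derivative \<gamma> (at (P z0)) (P v)" for z0 v
  have \<nu>\<nu>: "\<nu> \<bullet> \<nu> = 1" using \<nu> by (simp add: dot_square_norm)
  have P: "linear P" unfolding P_def by (auto intro!: linearI simp: algebra_simps inner_add_left)
  have absnu: "\<bar>v \<bullet> \<nu>\<bar> \<le> norm v" for v using Cauchy_Schwarz_ineq2[of v \<nu>] \<nu> by simp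
  \<comment> \<open>A crude bound for the projection; it is the origin of the factors 2 and 4 in the
    values given to \<open>B\<close> and \<open>K\<close>.\<close>
  have Pnorm: "norm (P v) \<le> 2 * norm v" for v
    using norm_triangle_ineq4[of v "(v \<bullet> \<nu>) *\<^sub>R \<nu>"] absnu[of v] \<nu> by (simp add: P_def)
  have diff: "\<gamma> differentiable (at z)" for z using Ck_differentiable \<gamma>(1) assms(1) by fastforce
  then have \<gamma>lin: "linear (frechet_derivative \<gamma> (at z))" for z
    using frechet_derivative_works has_derivative_linear by blast
  obtain M where M: "0 \<le> M" "holder_norm l \<beta> \<gamma> = ennreal M"
    using \<gamma>(2) by (metis ennreal_cases infinity_ennreal_def less_irrefl)
  have part: "\<bar>iter_partial I \<gamma> z\<bar> \<le> M" if "set I \<subseteq> Basis" "length I \<le> 2" for I z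
    using iter_partial_le_holder_norm[of I l \<gamma> z \<beta>] that assms(1) M by simp
  have "continuous_on UNIV P" using P by (simp add: linear_continuous_on linear_conv_bounded_linear)
  moreover have "continuous_on UNIV \<gamma>" using Ck_continuous_on[OF \<gamma>(1)] assms(1) by simp
  ultimately have "continuous_on UNIV (\<lambda>z. \<gamma> (P z))"
    by (metis continuous_on_compose2 subset_UNIV)
  then have contF: "continuous_on UNIV F"
    unfolding F_def by (intro continuous_intros)
  then have openF: "open {z. F z < 0}" "open {z. 0 < F z}"
    by (auto intro!: open_Collect_less)
  have in_U: "z \<in> U \<longleftrightarrow> 0 < F z" if "z \<in> ball x \<rho>" for z
  proof -
    have "z \<in> U \<inter> ball x \<rho> \<longleftrightarrow> z \<in> {y \<in> ball x \<rho>. \<gamma> (y - (y \<bullet> \<nu>) *\<^sub>R \<nu>) < y \<bullet> \<nu>}"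
      by (simp only: graph)
    then show ?thesis using that by (simp add: F_def P_def)
  qed
  \<comment> \<open>Near \<open>x\<close> the set where \<open>F\<close> is negative is open and
    misses \<open>U\<close>, so it misses the closure of \<open>U\<close> as well.\<close>
  have in_E: "0 \<le> F z" if "z \<in> ball x \<rho>" "z \<in> E" for z
  proof (rule ccontr)
    assume "\<not> 0 \<le> F z"
    then have "z \<in> ball x \<rho> \<inter> {z. F z < 0}" using that by auto
    moreover have "U \<inter> (ball x \<rho> \<inter> {z. F z < 0}) = {}" using in_U by force
    then have "closure U \<inter> (ball x \<rho> \<inter> {z. F z < 0}) = {}"
      using open_Int_closure_eq_empty[of "ball x \<rho> \<inter> {z. F z < 0}" U] openF by (simp add: Int_commute open_Int)
    ultimately show False using that U(3) by auto
  qed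
  have notin_E: "F z \<le> 0" if "z \<in> ball x \<rho>" "z \<notin> E" for z
    using that in_U[of z] U(3) closure_subset[of U] by force
  show ?thesis
  proof (rule that[OF \<rho> \<nu>, of "1 + 2 * (real DIM('a) * M)" "4 * ((real DIM('a))\<^sup>2 * M)" F D])
    show "F z = 0" if "z \<in> ball x \<rho>" "z \<in> frontier E" for z
    proof -
      have "z \<in> E" using that U(3) by (auto simp: frontier_def)
      then have "0 \<le> F z" using in_E that by blast
      moreover have "\<not> 0 < F z"
      proof
        assume "0 < F z"
        moreover have "ball x \<rho> \<inter> {z. 0 < F z} \<subseteq> E" using notin_E by force
        then have "ball x \<rho> \<inter> {z. 0 < F z} \<subseteq> interior E"
          by (rule interior_maximal) (simp add: openF open_Int)
        ultimately show False using that by (auto simp: frontier_def)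
      qed
      ultimately show ?thesis by simp
    qed
    show "linear (D z0)" for z0
      unfolding D_def using linear_compose[OF P \<gamma>lin[of "P z0"]]
      by (intro linear_compose_sub) (auto simp: o_def inner_add_left intro!: linearI)
    show "D z0 \<nu> = 1" for z0
      using \<gamma>lin[of "P z0"] by (simp add: D_def P_def \<nu>\<nu> linear_0)
    show "\<bar>D z0 v\<bar> \<le> (1 + 2 * (real DIM('a) * M)) * norm v" for z0 v
    proof -
      have "\<bar>frechet_derivative \<gamma> (at (P z0)) (P v)\<bar> \<le> real DIM('a) * M * norm (P v)"
        using linear_norm_le_Basis[OF \<gamma>lin[of "P z0"], of M "P v"] part[of "[_]" "P z0"] by simp
      also have "\<dots> \<le> real DIM('a) * M * (2 * norm v)"
        using M by (intro mult_left_mono Pnorm) auto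
      finally show ?thesis using absnu[of v] by (simp add: D_def algebra_simps)
    qed
    show "\<bar>F z - F z0 - D z0 (z - z0)\<bar> \<le> 4 * ((real DIM('a))\<^sup>2 * M) * (norm (z - z0))\<^sup>2" for z0 z
    proof -
      have PP: "P z - P z0 = P (z - z0)" using P by (simp add: linear_diff)
      have "F z - F z0 - D z0 (z - z0) =
          - (\<gamma> (P z) - \<gamma> (P z0) - frechet_derivative \<gamma> (at (P z0)) (P z - P z0))"
        by (simp add: F_def D_def PP inner_diff_left)
      then have "\<bar>F z - F z0 - D z0 (z - z0)\<bar> \<le> (real DIM('a))\<^sup>2 * M * (norm (P (z - z0)))\<^sup>2"
        using C2_Taylor[of \<gamma> M "P z" "P z0"] diff Ck_derivative_differentiable[OF \<gamma>(1) assms(1)] part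
        by (simp del: iter_partial.simps add: PP)
      also have "\<dots> \<le> (real DIM('a))\<^sup>2 * M * (2 * norm (z - z0))\<^sup>2"
        using M by (intro mult_left_mono power_mono Pnorm) auto
      finally show ?thesis by (simp add: power_mult_distrib mult_ac)
    qed
    show "negligible {z. F z = 0}"
      using negligible_graph[OF \<nu> diff] by (simp add: F_def P_def)
  qed (use M in_E notin_E in \<open>simp_all del: mem_ball\<close>)
qed

text \<open>Negligibility is a local property, and near each of its points the frontier lies in the
  zero set of a defining function. Convergence of membership off the frontier is therefore
  convergence almost everywhere.\<close>

lemma class_C_negligible_frontier:
  fixes E :: "'a::euclidean_space set"
  assumes "l \<ge> 2" "E \<in> class_C l \<beta>"
  shows "negligible (frontier E)"
proof (rule locally_negligible_alt[THEN iffD2], rule ballI)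
  fix x assume x: "x \<in> frontier E"
  show "\<exists>U. openin (top_of_set (frontier E)) U \<and> x \<in> U \<and> negligible U"
  proof (rule class_C_defining_function[OF assms x])
    fix \<rho> \<nu> and F :: "'a \<Rightarrow> real" and D :: "'a \<Rightarrow> 'a \<Rightarrow> real" and B K :: real
    assume \<rho>: "0 < \<rho>" and F: "\<And>z. z \<in> ball x \<rho> \<Longrightarrow> z \<in> frontier E \<Longrightarrow> F z = 0"
      "negligible {z. F z = 0}"
    have "negligible (frontier E \<inter> ball x \<rho>)"
      by (rule negligible_subset[OF F(2)]) (use F(1) in auto)
    then show ?thesis
      using x \<rho> by (intro exI[of _ "frontier E \<inter> ball x \<rho>"]) (auto simp: openin_open_Int)
  qed
qed

section \<open>Estimates along a converging sequence of sets\<close>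

lemma converges_C_eventually_close:
  fixes En :: "nat \<Rightarrow> 'a::euclidean_space set"
  assumes "converges_C l \<beta> En E" "0 < \<epsilon>"
  shows "\<forall>\<^sub>F n in sequentially. \<exists>\<Phi>. Ck_diffeo l \<Phi> \<and> En n = \<Phi> ` E \<and>
    (\<forall>I z. set I \<subseteq> Basis \<longrightarrow> length I \<le> l \<longrightarrow> norm (iter_partial I (\<lambda>x. \<Phi> x - x) z) \<le> \<epsilon>)"
proof -
  from assms(1) obtain \<Phi> where \<Phi>: "\<And>n. Ck_diffeo l (\<Phi> n)" "\<And>n. En n = \<Phi> n ` E"
    and lim: "(\<lambda>n. holder_norm l \<beta> (\<lambda>x. \<Phi> n x - x)) \<longlonglongrightarrow> 0"
    unfolding converges_C_def by auto
  have "\<forall>\<^sub>F n in sequentially. holder_norm l \<beta> (\<lambda>x. \<Phi> n x - x) < ennreal \<epsilon>"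
    using lim assms(2) by (intro order_tendstoD(2)) auto
  then show ?thesis
  proof eventually_elim
    case (elim n)
    have "norm (iter_partial I (\<lambda>x. \<Phi> n x - x) z) \<le> \<epsilon>"
      if "set I \<subseteq> Basis" "length I \<le> l" for I z
    proof -
      have "ennreal (norm (iter_partial I (\<lambda>x. \<Phi> n x - x) z)) \<le> ennreal \<epsilon>"
        using iter_partial_le_holder_norm[OF that, of "\<lambda>x. \<Phi> n x - x" z \<beta>] elim by simp
      then show ?thesis using assms(2) by simp
    qed
    with \<Phi> show ?case by (intro exI[of _ "\<Phi> n"]) auto
  qed
qed

lemma converges_C_eventually_uniform:
  fixes En :: "nat \<Rightarrow> 'a::euclidean_space set"
  assumes "converges_C l \<beta> En E" "0 < \<epsilon>"
  shows "\<forall>\<^sub>F n in sequentially. \<exists>\<Phi>. bij \<Phi> \<and> En n = \<Phi> ` E \<and> (\<forall>z. norm (\<Phi> z - z) \<le> \<epsilon>)"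
  using converges_C_eventually_close[OF assms]
proof eventually_elim
  case (elim n)
  then obtain \<Phi> where \<Phi>: "Ck_diffeo l \<Phi>" "En n = \<Phi> ` E"
    and *: "\<And>I z. set I \<subseteq> Basis \<Longrightarrow> length I \<le> l \<Longrightarrow> norm (iter_partial I (\<lambda>x. \<Phi> x - x) z) \<le> \<epsilon>"
    by auto
  from *[of "[]"] \<Phi> show ?case by (auto simp: Ck_diffeo_def)
qed

text \<open>A ball around \<open>y\<close> lies in \<open>E\<close> or in its complement, and the
  preimage of \<open>y\<close> under a bijection that moves points by at most half the radius stays
  in that ball.\<close>

lemma converges_C_eventually_mem_iff:
  assumes "converges_C l \<beta> En E" "y \<notin> frontier E"
  shows "\<forall>\<^sub>F n in sequentially. y \<in> En n \<longleftrightarrow> y \<in> E"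
proof -
  obtain \<epsilon> where \<epsilon>: "0 < \<epsilon>" "ball y \<epsilon> \<subseteq> E \<or> ball y \<epsilon> \<subseteq> - E"
  proof (cases "y \<in> interior E")
    case True
    then show ?thesis using that by (auto simp: mem_interior)
  next
    case False
    with assms(2) have "y \<in> interior (- E)" by (simp add: frontier_def interior_complement)
    then show ?thesis using that by (auto simp: mem_interior)
  qed
  have "0 < \<epsilon> / 2" using \<epsilon> by simp
  from converges_C_eventually_uniform[OF assms(1) this] show ?thesis
  proof eventually_elim
    case (elim n)
    then obtain \<Phi> where \<Phi>: "bij \<Phi>" "En n = \<Phi> ` E" "\<And>z. norm (\<Phi> z - z) \<le> \<epsilon> / 2" by auto
    define z where "z = inv \<Phi> y"
    have y: "y = \<Phi> z" using \<Phi>(1) by (simp add: z_def bij_is_surj surj_f_inv_f)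
    have "z \<in> ball y \<epsilon>" "y \<in> ball y \<epsilon>" using \<Phi>(3)[of z] \<epsilon> by (auto simp: y dist_norm)
    moreover have "y \<in> En n \<longleftrightarrow> z \<in> E"
      using \<Phi> by (simp add: y inj_image_mem_iff bij_is_inj)
    ultimately show ?case using \<epsilon>(2) by blast
  qed
qed

text \<open>The sign of \<open>F\<close> at the preimage of \<open>y\<close> tells on which side of
  the boundary of \<open>En n\<close> the point \<open>y\<close> lies, and this value of
  \<open>F\<close> is linear in \<open>y - x\<close> up to a quadratic error. Only \<open>w\<close>
  varies with \<open>n\<close>.\<close>

lemma converges_C_slab:
  fixes E :: "'a::euclidean_space set"
  assumes "l \<ge> 2" and En: "\<And>n. En n \<in> class_C l \<beta>" and E: "E \<in> class_C l \<beta>"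
    and conv: "converges_C l \<beta> En E" and x: "x \<in> frontier E" "\<And>n. x \<in> frontier (En n)"
  obtains \<rho> C where "0 < \<rho>" "0 < C"
    "\<forall>\<^sub>F n in sequentially. \<exists>w. 2/3 \<le> norm w \<and> (\<forall>y\<in>ball x \<rho>.
       (y \<in> En n \<longrightarrow> - (C * (norm (y - x))\<^sup>2) \<le> w \<bullet> (y - x)) \<and>
       (y \<notin> En n \<longrightarrow> w \<bullet> (y - x) \<le> C * (norm (y - x))\<^sup>2))"
proof (rule class_C_defining_function[OF assms(1) E x(1)])
  fix \<rho> \<nu> and F :: "'a \<Rightarrow> real" and D :: "'a \<Rightarrow> 'a \<Rightarrow> real" and B K :: real
  assume \<rho>: "0 < \<rho>" and \<nu>: "norm \<nu> = 1" and nonneg: "0 \<le> B" "0 \<le> K"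
    and FE: "\<And>z. z \<in> ball x \<rho> \<Longrightarrow> z \<in> E \<Longrightarrow> 0 \<le> F z"
      "\<And>z. z \<in> ball x \<rho> \<Longrightarrow> z \<notin> E \<Longrightarrow> F z \<le> 0"
      "\<And>z. z \<in> ball x \<rho> \<Longrightarrow> z \<in> frontier E \<Longrightarrow> F z = 0"
    and D: "\<And>z0. linear (D z0)" "\<And>z0. D z0 \<nu> = 1" "\<And>z0 v. \<bar>D z0 v\<bar> \<le> B * norm v"
    and F: "\<And>z0 z. \<bar>F z - F z0 - D z0 (z - z0)\<bar> \<le> K * (norm (z - z0))\<^sup>2"
  \<comment> \<open>The first bound makes the displacement Lipschitz with constant 1/2, after
    summation over the basis; the second keeps the preimages of points of
    \<open>ball x (\<rho> / 2)\<close> in the ball where \<open>F\<close> describes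
    \<open>E\<close>.\<close>
  define \<epsilon> where "\<epsilon> = min (1 / (2 * real DIM('a))) (\<rho> / 2)"
  define M where "M = (real DIM('a))\<^sup>2 * \<epsilon>"
  \<comment> \<open>The constant of \<open>quadratic_approx_of_image\<close>; the summand 1 makes it
    positive.\<close>
  define C where "C = 8 * B * M + 4 * K + 1"
  have \<epsilon>: "0 < \<epsilon>" "real DIM('a) * \<epsilon> \<le> 1/2" "\<epsilon> \<le> \<rho> / 2"
    using \<rho> by (auto simp: \<epsilon>_def min_def field_simps)
  have M: "0 \<le> M" using \<epsilon> by (simp add: M_def)
  have C: "0 < C" using M nonneg by (auto simp: C_def intro!: add_nonneg_pos)
  have "\<forall>\<^sub>F n in sequentially. \<exists>w. 2/3 \<le> norm w \<and> (\<forall>y\<in>ball x (\<rho> / 2).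
       (y \<in> En n \<longrightarrow> - (C * (norm (y - x))\<^sup>2) \<le> w \<bullet> (y - x)) \<and>
       (y \<notin> En n \<longrightarrow> w \<bullet> (y - x) \<le> C * (norm (y - x))\<^sup>2))"
    using converges_C_eventually_close[OF conv \<epsilon>(1)]
  proof eventually_elim
    case (elim n)
    then obtain \<Phi> where \<Phi>: "Ck_diffeo l \<Phi>" "En n = \<Phi> ` E"
      and part: "\<And>I z. set I \<subseteq> Basis \<Longrightarrow> length I \<le> l \<Longrightarrow> norm (iter_partial I (\<lambda>x. \<Phi> x - x) z) \<le> \<epsilon>"
      by auto
    let ?f = "\<lambda>x. \<Phi> x - x"
    have bij: "bij \<Phi>" and Ck: "Ck l \<Phi>" "Ck l (inv \<Phi>)" using \<Phi>(1) by (auto simp: Ck_diffeo_def)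
    have \<Phi>inv: "\<Phi> (inv \<Phi> y) = y" for y using bij by (simp add: bij_is_surj surj_f_inv_f)
    have mem: "y \<in> En n \<longleftrightarrow> inv \<Phi> y \<in> E" for y
      using \<Phi>(2) bij \<Phi>inv by (metis bij_is_inj inj_image_mem_iff)
    have D\<Phi>: "(\<Phi> has_derivative frechet_derivative \<Phi> (at z)) (at z)" for z
      using Ck_differentiable[OF Ck(1)] assms(1) frechet_derivative_works by fastforce
    have Df: "(?f has_derivative (\<lambda>v. frechet_derivative \<Phi> (at z) v - v)) (at z)" for z
      by (intro derivative_intros D\<Phi>)
    then have fd: "frechet_derivative ?f (at z) = (\<lambda>v. frechet_derivative \<Phi> (at z) v - v)" for z
      using frechet_derivative_at by metis
    have f1: "?f differentiable (at z)" for z using Df by (rule differentiableI)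
    have f2: "(\<lambda>z. frechet_derivative ?f (at z) v) differentiable (at z)" for z v
      unfolding fd using Ck_derivative_differentiable[OF Ck(1) assms(1)]
      by (intro differentiable_diff) auto
    have fb: "norm (frechet_derivative ?f (at z) b) \<le> \<epsilon>" if "b \<in> Basis" for z b
      using part[of "[b]" z] that assms(1) by simp
    define z0 where "z0 = inv \<Phi> x"
    have x_eq: "\<Phi> z0 = x" by (simp add: z0_def \<Phi>inv)
    have close: "norm (\<Phi> z - z) \<le> \<epsilon>" for z using part[of "[]" z] by simp
    \<comment> \<open>By continuity of the inverse, an interior point \<open>z0\<close> of
      \<open>E\<close> would make \<open>x\<close> interior to \<open>En n\<close>. Being on the
      frontier gives \<open>F z0 = 0\<close>, so the expansion at \<open>z0\<close> has no constant
      term.\<close>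
    have "z0 \<in> frontier E"
    proof -
      have "x \<in> En n" using x(2)[of n] class_C_closed[OF En[of n]] by (auto simp: frontier_def)
      then have "z0 \<in> E" by (simp add: mem z0_def)
      moreover have "z0 \<notin> interior E"
      proof
        assume "z0 \<in> interior E"
        have "open (inv \<Phi> -` interior E)"
          using Ck_continuous_on[OF Ck(2)] assms(1) by (intro open_vimage) auto
        moreover have "inv \<Phi> -` interior E \<subseteq> En n" using mem interior_subset by auto
        moreover have "x \<in> inv \<Phi> -` interior E" using \<open>z0 \<in> interior E\<close> by (simp add: z0_def)
        ultimately have "x \<in> interior (En n)" by (meson interiorI)
        then show False using x(2)[of n] by (simp add: frontier_def)
      qed
      ultimately show ?thesis using class_C_closed[OF E] by (simp add: frontier_def)
    qed
    moreover have "z0 \<in> ball x \<rho>" using close[of z0] \<epsilon> \<rho> by (simp add: x_eq dist_norm)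
    ultimately have Fz0: "F z0 = 0" by (simp add: FE)
    let ?A = "frechet_derivative \<Phi> (at z0)"
    obtain w where w: "2/3 \<le> norm w"
      "\<And>z. \<bar>F z - w \<bullet> (\<Phi> z - \<Phi> z0)\<bar> \<le> (8 * B * M + 4 * K) * (norm (\<Phi> z - \<Phi> z0))\<^sup>2"
    proof (rule quadratic_approx_of_image[of \<Phi> z0 ?A M "D z0" B \<nu> F K])
      show "norm (?f z - ?f z0) \<le> norm (z - z0) / 2" for z
        using lipschitz_of_partial_bound[OF f1 fb, of z z0]
          mult_right_mono[OF \<epsilon>(2), of "norm (z - z0)"] by simp
      show "linear ?A" using D\<Phi> by (rule has_derivative_linear)
      show "norm (?A v - v) \<le> norm v / 2" for v
        using linear_norm_le_Basis[OF has_derivative_linear[OF Df], of z0 \<epsilon> v] fb[of _ z0]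
          mult_right_mono[OF \<epsilon>(2), of "norm v"] by (simp add: fd)
      \<comment> \<open>Subtracting the identity does not change the second-order remainder, so the
        second derivatives of the displacement control it.\<close>
      show "norm (\<Phi> z - \<Phi> z0 - ?A (z - z0)) \<le> M * (norm (z - z0))\<^sup>2" for z
      proof -
        have "norm (?f z - ?f z0 - frechet_derivative ?f (at z0) (z - z0)) \<le> M * (norm (z - z0))\<^sup>2"
          unfolding M_def
          by (intro C2_Taylor f1 f2) (use part assms(1) in \<open>auto simp del: iter_partial.simps\<close>)
        then show ?thesis by (simp add: fd)
      qed
      show "\<bar>F z - D z0 (z - z0)\<bar> \<le> K * (norm (z - z0))\<^sup>2" for z
        using F[of z z0] by (simp add: Fz0)
    qed (use D \<nu> M nonneg in auto)
    have "(y \<in> En n \<longrightarrow> - (C * (norm (y - x))\<^sup>2) \<le> w \<bullet> (y - x)) \<and>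
       (y \<notin> En n \<longrightarrow> w \<bullet> (y - x) \<le> C * (norm (y - x))\<^sup>2)" if y: "y \<in> ball x (\<rho> / 2)" for y
    proof -
      let ?z = "inv \<Phi> y"
      have "norm (y - ?z) \<le> \<rho> / 2" using close[of ?z] \<epsilon> by (simp add: \<Phi>inv)
      then have z: "?z \<in> ball x \<rho>"
        using y norm_triangle_ineq[of "x - y" "y - ?z"] by (simp add: dist_norm)
      have "\<bar>F ?z - w \<bullet> (y - x)\<bar> \<le> C * (norm (y - x))\<^sup>2"
        using w(2)[of ?z] zero_le_power2[of "norm (y - x)"]
        unfolding \<Phi>inv x_eq C_def distrib_right by linarith
      then show ?thesis using FE(1,2)[OF z] unfolding mem by auto
    qed
    with w(1) show ?case by blast
  qed
  with C \<rho> show thesis by (intro that[of "\<rho> / 2" C]) auto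
qed

section \<open>Curvatures as limits of annulus integrals\<close>

definition phase :: "'a set \<Rightarrow> 'a \<Rightarrow> real" where
  "phase E y = indicator (UNIV - E) y - indicator E y"

lemma phase_simps [simp]: "y \<in> E \<Longrightarrow> phase E y = - 1" "y \<notin> E \<Longrightarrow> phase E y = 1"
  by (auto simp: phase_def)

lemma abs_phase_le: "\<bar>phase E y\<bar> \<le> 1"
  by (cases "y \<in> E") auto

lemma borel_measurable_phase [measurable]:
  fixes E :: "'a::euclidean_space set"
  assumes "closed E"
  shows "phase E \<in> borel_measurable borel"
proof -
  have "E \<in> sets borel" "UNIV - E \<in> sets borel" using assms by auto
  then show ?thesis
    unfolding phase_def[abs_def] by (intro borel_measurable_diff borel_measurable_indicator)
qed

lemma borel_measurable_phase_reflect: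
  fixes E :: "'a::euclidean_space set"
  assumes "closed E"
  shows "(\<lambda>v. phase E (x - v)) \<in> borel_measurable borel"
  using borel_measurable_phase[OF assms] by measurable

text \<open>For Borel integrands the completed measure can be replaced by \<open>lborel\<close>; the
  substitution \<open>y = x - v\<close> then moves the singularity at \<open>x\<close> to the
  origin.\<close>

lemma set_integral_lebesgue_reflect:
  fixes f :: "'a::euclidean_space \<Rightarrow> real"
  assumes "S \<in> sets borel" "f \<in> borel_measurable borel"
  shows "(LINT y:S|lebesgue. f y) = (LINT v|lborel. indicator S (x - v) * f (x - v))"
proof -
  have m: "(\<lambda>y. indicator S y * f y) \<in> borel_measurable borel"
    using assms by (intro borel_measurable_times borel_measurable_indicator)
  have "(LINT y:S|lebesgue. f y) = (LINT y|lborel. indicator S y * f y)"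
    unfolding set_lebesgue_integral_def real_scaleR_def using m by (intro integral_completion) simp
  then show ?thesis using integral_lborel_reflect[OF m, of x] by simp
qed

lemma trunc_integral_eq_annulus:
  fixes E :: "'a::euclidean_space set"
  assumes "closed E" "0 < r"
  shows "(LINT y : ball x R - ball x r | lebesgue.
      (indicator (UNIV - E) y - indicator E y) / norm (x - y) ^ DIM('a)) =
    annulus_integral (real DIM('a)) r R (\<lambda>v. phase E (x - v))"
proof -
  have pow: "norm v ^ DIM('a) = norm v powr real DIM('a)" if "\<not> norm v < r" for v :: 'a
    using that assms(2) by (intro powr_realpow[symmetric]) auto
  have "(LINT y : ball x R - ball x r | lebesgue. phase E y / norm (x - y) ^ DIM('a)) =
      (LINT v|lborel. indicator (ball x R - ball x r) (x - v) * (phase E (x - v) / norm (x - (x - v)) ^ DIM('a)))"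
    using borel_measurable_phase[OF assms(1)]
    by (intro set_integral_lebesgue_reflect borel_measurable_divide borel_measurable_power) auto
  also have "\<dots> = annulus_integral (real DIM('a)) r R (\<lambda>v. phase E (x - v))"
    unfolding annulus_integral_def
    by (intro Bochner_Integration.integral_cong) (auto simp: pow dist_norm split: split_indicator)
  finally show ?thesis by (simp add: phase_def)
qed

text \<open>Outside \<open>ball x R\<close> the phase is the constant \<open>\<sigma>\<close>, so
  the tail is an explicit radial integral that does not involve \<open>r\<close>.\<close>

lemma frac_integral_eq_annulus:
  fixes E :: "'a::euclidean_space set"
  assumes "closed E" "0 < r" "r \<le> R" "0 < s"
    and far: "\<And>y. y \<notin> ball x R \<Longrightarrow> phase E y = \<sigma>"
  shows "(LINT y : UNIV - ball x r | lebesgue.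
      (indicator (UNIV - E) y - indicator E y) / norm (x - y) powr (real DIM('a) + s)) =
    annulus_integral (real DIM('a) + s) r R (\<lambda>v. phase E (x - v)) +
      \<sigma> * (dim_omega TYPE('a) * R powr (- s) / s)"
proof -
  let ?p = "real DIM('a) + s"
  let ?h = "\<lambda>v. phase E (x - v)"
  have far': "?h v = \<sigma>" if "v \<notin> ball 0 R" for v
    using that by (intro far) (simp add: dist_norm)
  have "(LINT y : UNIV - ball x r | lebesgue. phase E y / norm (x - y) powr ?p) =
      (LINT v|lborel. indicator (UNIV - ball x r) (x - v) * (phase E (x - v) / norm (x - (x - v)) powr ?p))"
    using borel_measurable_phase[OF assms(1)]
    by (intro set_integral_lebesgue_reflect borel_measurable_divide powr_real_measurable) auto
  also have "\<dots> = (LINT v|lborel. indicator (ball 0 R - ball 0 r) v * (?h v / norm v powr ?p) +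
      \<sigma> * (indicator (- ball 0 R) v / norm v powr ?p))"
    using far' assms(3)
    by (intro Bochner_Integration.integral_cong) (auto simp: dist_norm split: split_indicator)
  also have "\<dots> = annulus_integral ?p r R ?h + \<sigma> * (dim_omega TYPE('a) * R powr (- s) / s)"
  proof -
    have "has_bochner_integral lborel (\<lambda>v. \<sigma> * (indicator (- ball 0 R) v / norm (v::'a) powr ?p))
        (\<sigma> * (dim_omega TYPE('a) * R powr (- s) / s))"
      using assms by (intro has_bochner_integral_mult_right has_bochner_integral_outside_ball) auto
    moreover have "has_bochner_integral lborel
        (\<lambda>v. indicator (ball 0 R - ball 0 r) v * (?h v / norm v powr ?p)) (annulus_integral ?p r R ?h)"
      unfolding annulus_integral_def
      using assms borel_measurable_phase_reflect[OF assms(1)] abs_phase_le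
      by (intro has_bochner_integral_integrable integrable_annulus) auto
    ultimately show ?thesis
      by (intro has_bochner_integral_integral_eq has_bochner_integral_add)
  qed
  finally show ?thesis by (simp add: phase_def)
qed

text \<open>Enlarging the ball beyond \<open>R0\<close> only adds a logarithm. After renormalisation
  the truncated curvature is constant in \<open>R \<ge> R0\<close>, and the outer limit becomes
  trivial.\<close>

lemma trunc_curv0_eq:
  fixes E :: "'a::euclidean_space set"
  assumes "closed E" "0 < R0" "R0 \<le> R"
    and far: "\<And>y. y \<notin> ball x R0 \<Longrightarrow> phase E y = \<sigma>"
    and L: "((\<lambda>r. annulus_integral (real DIM('a)) r R0 (\<lambda>v. phase E (x - v))) \<longlongrightarrow> L) (at_right 0)"
  shows "trunc_curv0 R x E = L + \<sigma> * dim_omega TYPE('a) * ln (R / R0)"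
proof -
  let ?h = "\<lambda>v. phase E (x - v)"
  let ?I = "annulus_integral (real DIM('a))"
  have "?I R0 R ?h = (LINT v|lborel. \<sigma> * (indicator (ball 0 R - ball 0 R0) v / norm (v::'a) powr real DIM('a)))"
    unfolding annulus_integral_def
    by (intro Bochner_Integration.integral_cong)
      (use far in \<open>auto simp: dist_norm split: split_indicator\<close>)
  also have "\<dots> = \<sigma> * (dim_omega TYPE('a) * ln (R / R0))"
    using assms
    by (intro has_bochner_integral_integral_eq has_bochner_integral_mult_right has_bochner_integral_annulus)
  finally have outer: "?I R0 R ?h = \<sigma> * dim_omega TYPE('a) * ln (R / R0)" by simp
  have "\<forall>\<^sub>F r in at_right 0. ?I r R0 ?h + ?I R0 R ?h = (LINT y : ball x R - ball x r | lebesgue.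
      (indicator (UNIV - E) y - indicator E y) / norm (x - y) ^ DIM('a))"
  proof (rule eventually_at_rightI)
    fix r assume "r \<in> {0<..<R0}"
    then show "?I r R0 ?h + ?I R0 R ?h = (LINT y : ball x R - ball x r | lebesgue.
      (indicator (UNIV - E) y - indicator E y) / norm (x - y) ^ DIM('a))"
      using trunc_integral_eq_annulus[OF assms(1), of r x R] assms(3)
        annulus_integral_split[OF borel_measurable_phase_reflect[OF assms(1)] abs_phase_le, of r "real DIM('a)" R0 R x]
      by simp
  qed fact
  moreover have "((\<lambda>r. ?I r R0 ?h + ?I R0 R ?h) \<longlongrightarrow> L + ?I R0 R ?h) (at_right 0)"
    by (intro tendsto_intros L)
  ultimately have "((\<lambda>r. LINT y : ball x R - ball x r | lebesgue.
      (indicator (UNIV - E) y - indicator E y) / norm (x - y) ^ DIM('a)) \<longlongrightarrow> L + ?I R0 R ?h) (at_right 0)"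
    by (rule Lim_transform_eventually[rotated])
  then show ?thesis
    unfolding trunc_curv0_def outer by (intro tendsto_Lim) auto
qed

text \<open>\<open>Lim\<close> has a usable value only where a limit exists; \<open>L\<close>
  provides it, and the tail is a constant added to the annulus integral.\<close>

lemma frac_curv_eq:
  fixes E :: "'a::euclidean_space set"
  assumes "closed E" "0 < R" "0 < s"
    and far: "\<And>y. y \<notin> ball x R \<Longrightarrow> phase E y = \<sigma>"
    and L: "((\<lambda>r. annulus_integral (real DIM('a) + s) r R (\<lambda>v. phase E (x - v))) \<longlongrightarrow> L) (at_right 0)"
  shows "frac_curv s x E = L + \<sigma> * (dim_omega TYPE('a) * R powr (- s) / s)"
proof -
  let ?T = "\<sigma> * (dim_omega TYPE('a) * R powr (- s) / s)"
  let ?I = "\<lambda>r. annulus_integral (real DIM('a) + s) r R (\<lambda>v. phase E (x - v))"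
  have "\<forall>\<^sub>F r in at_right 0. ?I r + ?T = (LINT y : UNIV - ball x r | lebesgue.
      (indicator (UNIV - E) y - indicator E y) / norm (x - y) powr (real DIM('a) + s))"
  proof (rule eventually_at_rightI)
    fix r assume "r \<in> {0<..<R}"
    then show "?I r + ?T = (LINT y : UNIV - ball x r | lebesgue.
      (indicator (UNIV - E) y - indicator E y) / norm (x - y) powr (real DIM('a) + s))"
      using frac_integral_eq_annulus[of E r R s x \<sigma>] assms by simp
  qed fact
  moreover have "((\<lambda>r. ?I r + ?T) \<longlongrightarrow> L + ?T) (at_right 0)"
    by (intro tendsto_intros L)
  ultimately have "((\<lambda>r. LINT y : UNIV - ball x r | lebesgue.
      (indicator (UNIV - E) y - indicator E y) / norm (x - y) powr (real DIM('a) + s)) \<longlongrightarrow> L + ?T) (at_right 0)"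
    by (rule Lim_transform_eventually[rotated])
  then show ?thesis
    unfolding frac_curv_def by (intro tendsto_Lim) auto
qed

section \<open>The renormalised limit\<close>

text \<open>This is the derivative of \<open>\<lambda>t. R powr (- t)\<close> at zero; positivity of
  \<open>s n\<close> keeps the sequence off zero itself.\<close>

lemma tendsto_powr_difference_quotient:
  fixes s :: "nat \<Rightarrow> real"
  assumes "\<And>n. 0 < s n" "s \<longlonglongrightarrow> 0" "0 < R"
  shows "(\<lambda>n. (R powr (- s n) - 1) / s n) \<longlonglongrightarrow> - ln R"
proof -
  have "((\<lambda>t. R powr (- t)) has_real_derivative - ln R) (at 0)"
    using assms(3) by (auto intro!: derivative_eq_intros)
  then have "((\<lambda>t. (R powr (- t) - 1) / t) \<longlongrightarrow> - ln R) (at 0)"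
    using assms(3) by (simp add: has_field_derivative_iff)
  moreover have "filterlim s (at 0) sequentially"
    using assms(1,2) by (simp add: filterlim_at less_imp_neq[symmetric])
  ultimately show ?thesis by (rule filterlim_compose)
qed

text \<open>The renormalised curvature is \<open>Ln n\<close>, the part inside
  \<open>ball x R\<close>, plus a multiple of \<open>(R powr (- s n) - 1) / s n\<close>. The first
  converges by the exchange of limits, the second to a multiple of \<open>- ln R\<close>. The
  parameter \<open>\<sigma>\<close> lets one proof serve for both signs.\<close>

lemma frac_curv_renormalized_limit:
  fixes E :: "'a::euclidean_space set"
  assumes "l \<ge> 2" and s: "\<And>n. 0 < s n" "s \<longlonglongrightarrow> 0"
    and En: "\<And>n. En n \<in> class_C l \<beta>" and E: "E \<in> class_C l \<beta>"
    and conv: "converges_C l \<beta> En E" and x: "x \<in> frontier E" "\<And>n. x \<in> frontier (En n)"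
    and R: "0 < R" "\<And>y. y \<notin> ball x R \<Longrightarrow> phase E y = \<sigma>"
      "\<forall>\<^sub>F n in sequentially. \<forall>y. y \<notin> ball x R \<longrightarrow> phase (En n) y = \<sigma>"
  shows "(\<lambda>n. frac_curv (s n) x (En n) - \<sigma> * (dim_omega TYPE('a) / s n)) \<longlonglongrightarrow>
    Lim at_top (\<lambda>R. trunc_curv0 R x E - \<sigma> * (dim_omega TYPE('a) * ln R))"
proof -
  let ?d = "real DIM('a)"
  let ?\<omega> = "dim_omega TYPE('a)"
  let ?h = "\<lambda>E v. phase E (x - v)"
  have closed: "closed E" "\<And>n. closed (En n)" using class_C_closed E En by auto
  obtain \<rho>0 C where \<rho>0: "0 < \<rho>0" and C: "0 < C"
    and slab: "\<forall>\<^sub>F n in sequentially. \<exists>w. 2/3 \<le> norm w \<and> (\<forall>y\<in>ball x \<rho>0.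
       (y \<in> En n \<longrightarrow> - (C * (norm (y - x))\<^sup>2) \<le> w \<bullet> (y - x)) \<and>
       (y \<notin> En n \<longrightarrow> w \<bullet> (y - x) \<le> C * (norm (y - x))\<^sup>2))"
    by (rule converges_C_slab[OF assms(1) En E conv x])
  \<comment> \<open>At most \<open>\<rho>0\<close> for the slab, at most 1 for the square root
    bound, and at most \<open>R\<close> for splitting the annulus.\<close>
  define \<rho> where "\<rho> = min (min \<rho>0 1) R"
  have \<rho>: "0 < \<rho>" "\<rho> \<le> R" "\<rho> \<le> 1" "\<rho> \<le> \<rho>0" using \<rho>0 R(1) by (auto simp: \<rho>_def)
  define K where "K = 4 * (3 * 2 ^ DIM('a) * unit_ball_vol ?d * C / (2/3) * 2 ^ (DIM('a) + 1))"
  have "\<forall>\<^sub>F n in sequentially. s n < 1/2" using s(2) by (intro order_tendstoD(2)) auto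
  with slab have bound: "\<forall>\<^sub>F n in sequentially. \<forall>r m. 0 < r \<longrightarrow> r \<le> m \<longrightarrow> m \<le> \<rho> \<longrightarrow>
      \<bar>annulus_integral (?d + s n) r m (?h (En n))\<bar> \<le> K * sqrt m"
  proof eventually_elim
    case (elim n)
    then obtain w where w: "2/3 \<le> norm w"
      and slab: "\<And>y. y \<in> ball x \<rho>0 \<Longrightarrow> y \<in> En n \<Longrightarrow> - (C * (norm (y - x))\<^sup>2) \<le> w \<bullet> (y - x)"
        "\<And>y. y \<in> ball x \<rho>0 \<Longrightarrow> y \<notin> En n \<Longrightarrow> w \<bullet> (y - x) \<le> C * (norm (y - x))\<^sup>2"
      by auto
    \<comment> \<open>A non-zero sum means that \<open>x - v\<close> and \<open>x + v\<close> are
      both in \<open>En n\<close> or both outside. The same one-sided estimate then holds for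
      \<open>v\<close> and \<open>- v\<close>, which bounds the absolute value.\<close>
    have odd: "\<bar>w \<bullet> v\<bar> \<le> C * (norm v)\<^sup>2"
      if "norm v < \<rho>0" "?h (En n) v + ?h (En n) (- v) \<noteq> 0" for v
    proof -
      have b: "x - v \<in> ball x \<rho>0" "x + v \<in> ball x \<rho>0" using that(1) by (auto simp: dist_norm)
      have "x - v \<in> En n \<longleftrightarrow> x + v \<in> En n"
        using that(2) by (cases "x - v \<in> En n"; cases "x + v \<in> En n") auto
      then show ?thesis
        using slab(1)[OF b(1)] slab(1)[OF b(2)] slab(2)[OF b(1)] slab(2)[OF b(2)] by fastforce
    qed
    have "\<bar>annulus_integral (?d + s n) r m (?h (En n))\<bar> \<le> K * sqrt m"
      if "0 < r" "r \<le> m" "m \<le> \<rho>" for r m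
      unfolding K_def
      using borel_measurable_phase_reflect[OF closed(2)] abs_phase_le odd w C s(1)[of n] elim(2) that \<rho>
      by (intro annulus_integral_bound[where w = w and \<rho> = \<rho>0]) auto
    then show ?case by blast
  qed
  have "AE y in lborel. y \<notin> frontier E"
  proof (rule AE_not_in)
    have "frontier E \<in> sets borel" using closed(1) by simp
    then show "frontier E \<in> null_sets lborel"
      using class_C_negligible_frontier[OF assms(1) E]
      by (simp add: negligible_iff_null_sets null_sets_completion_iff)
  qed
  \<comment> \<open>The reflection preserves the measure, so the exceptional null set can be
    expressed in the variable \<open>v\<close>.\<close>
  then have "AE y in distr lborel borel (\<lambda>v. x - v). y \<notin> frontier E"
    by (subst lborel_reflect)
  moreover have "{y. y \<notin> frontier E} \<in> sets borel"
    using borel_open[OF open_Compl[OF frontier_closed[of E]]] by (simp only: Compl_eq)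
  ultimately have "AE v in lborel. x - v \<notin> frontier E"
    by (subst (asm) AE_distr_iff) auto
  then have lim: "AE v in lborel. (\<lambda>n. ?h (En n) v) \<longlonglongrightarrow> ?h E v"
  proof eventually_elim
    case (elim v)
    have "\<forall>\<^sub>F n in sequentially. ?h (En n) v = ?h E v"
      using converges_C_eventually_mem_iff[OF conv elim] by eventually_elim (simp add: phase_def indicator_def)
    then show ?case by (rule tendsto_eventually)
  qed
  have p: "0 \<le> ?d + s n" for n using s(1)[of n] by simp
  have q: "(\<lambda>n. ?d + s n) \<longlonglongrightarrow> ?d" using tendsto_add[OF tendsto_const s(2), of ?d] by simp
  obtain L Ln where L: "((\<lambda>r. annulus_integral ?d r R (?h E)) \<longlongrightarrow> L) (at_right 0)"
    and Ln: "\<forall>\<^sub>F n in sequentially.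
      ((\<lambda>r. annulus_integral (?d + s n) r R (?h (En n))) \<longlongrightarrow> Ln n) (at_right 0)" "Ln \<longlonglongrightarrow> L"
    by (rule annulus_integral_limits[where hn = "\<lambda>n. ?h (En n)" and h = "?h E",
          OF borel_measurable_phase_reflect[OF closed(2)] abs_phase_le
          borel_measurable_phase_reflect[OF closed(1)] abs_phase_le lim p q \<rho>(1,2) bound])
  have "\<forall>\<^sub>F T in at_top. L - \<sigma> * (?\<omega> * ln R) = trunc_curv0 T x E - \<sigma> * (?\<omega> * ln T)"
    using eventually_ge_at_top[of R]
  proof eventually_elim
    case (elim T)
    then show ?case
      using trunc_curv0_eq[OF closed(1) R(1) elim R(2) L] R(1) by (simp add: ln_div algebra_simps)
  qed
  then have "((\<lambda>T. trunc_curv0 T x E - \<sigma> * (?\<omega> * ln T)) \<longlongrightarrow> L - \<sigma> * (?\<omega> * ln R)) at_top"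
    by (rule Lim_transform_eventually[OF tendsto_const])
  then have Lim: "Lim at_top (\<lambda>T. trunc_curv0 T x E - \<sigma> * (?\<omega> * ln T)) = L + \<sigma> * ?\<omega> * - ln R"
    by (subst tendsto_Lim) (auto simp: mult.assoc)
  have "(\<lambda>n. Ln n + \<sigma> * ?\<omega> * ((R powr (- s n) - 1) / s n)) \<longlonglongrightarrow> L + \<sigma> * ?\<omega> * - ln R"
    by (intro tendsto_intros Ln tendsto_powr_difference_quotient s R(1))
  moreover have "\<forall>\<^sub>F n in sequentially. Ln n + \<sigma> * ?\<omega> * ((R powr (- s n) - 1) / s n) =
      frac_curv (s n) x (En n) - \<sigma> * (?\<omega> / s n)"
    using Ln(1) R(3)
  proof eventually_elim
    case (elim n)
    have "frac_curv (s n) x (En n) = Ln n + \<sigma> * (?\<omega> * R powr (- s n) / s n)"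
      using elim(2) by (intro frac_curv_eq[OF closed(2) R(1) s(1) _ elim(1)]) auto
    then show ?case by (simp add: diff_divide_distrib algebra_simps)
  qed
  ultimately show ?thesis unfolding Lim by (rule Lim_transform_eventually)
qed

text \<open>A bijection maps complements to complements, so one estimate of the displacement covers
  both cases. It yields a radius, common to all large \<open>n\<close>, beyond which the phase is
  constant.\<close>

lemma converges_C_eventually_subset_ball:
  fixes En :: "nat \<Rightarrow> 'a::euclidean_space set"
  assumes "converges_C l \<beta> En E" "0 < \<epsilon>"
  shows "\<forall>\<^sub>F n in sequentially. (E \<subseteq> ball x R \<longrightarrow> En n \<subseteq> ball x (R + \<epsilon>)) \<and>
    (- E \<subseteq> ball x R \<longrightarrow> - En n \<subseteq> ball x (R + \<epsilon>))"
  using converges_C_eventually_uniform[OF assms]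
proof eventually_elim
  case (elim n)
  then obtain \<Phi> where \<Phi>: "bij \<Phi>" "En n = \<Phi> ` E" "\<And>z. norm (\<Phi> z - z) \<le> \<epsilon>" by auto
  have *: "\<Phi> ` S \<subseteq> ball x (R + \<epsilon>)" if "S \<subseteq> ball x R" for S
  proof
    fix y assume "y \<in> \<Phi> ` S"
    then obtain z where "z \<in> ball x R" "y = \<Phi> z" using \<open>S \<subseteq> ball x R\<close> by auto
    then show "y \<in> ball x (R + \<epsilon>)"
      using \<Phi>(3)[of z] dist_triangle[of x y z] by (simp add: dist_norm norm_minus_commute)
  qed
  have "- En n = \<Phi> ` (- E)" using \<Phi>(1,2) by (simp add: bij_image_Compl_eq)
  with * \<Phi>(2) show ?case by simp
qed

lemma tendsto_mult_of_renormalized: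
  fixes f s :: "nat \<Rightarrow> real"
  assumes "\<And>n. 0 < s n" "s \<longlonglongrightarrow> 0" "(\<lambda>n. f n - c / s n) \<longlonglongrightarrow> L"
  shows "(\<lambda>n. s n * f n) \<longlonglongrightarrow> c"
proof -
  have "(\<lambda>n. s n * (f n - c / s n) + c) \<longlonglongrightarrow> 0 * L + c"
    by (intro tendsto_intros assms)
  moreover have "s n * (f n - c / s n) + c = s n * f n" for n
    using assms(1)[of n] by (simp add: right_diff_distrib)
  ultimately show ?thesis by simp
qed

text \<open>The sign of the term in \<open>1 / s n\<close> is that of the phase at infinity, in
  agreement with the sign of the logarithm in \<open>frac_curv0\<close>: positive for bounded
  \<open>E\<close>, reversed when the complement is bounded.\<close>

theorem theorem4p7:
  fixes l :: nat and \<beta> :: real and s :: "nat \<Rightarrow> real"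
    and En :: "nat \<Rightarrow> 'a::euclidean_space set" and E :: "'a set" and x :: 'a
  assumes "l \<ge> 2" and "0 \<le> \<beta>" and "\<beta> \<le> 1"
    and "\<And>n. 0 < s n \<and> s n < 1" and "s \<longlonglongrightarrow> 0"
    and "\<And>n. En n \<in> class_C l \<beta>" and "E \<in> class_C l \<beta>"
    and "converges_C l \<beta> En E"
    and "x \<in> frontier E" and "\<And>n. x \<in> frontier (En n)"
  shows "(bounded E \<longrightarrow>
            (\<lambda>n. frac_curv (s n) x (En n) - dim_omega TYPE('a) / s n) \<longlonglongrightarrow> frac_curv0 x E \<and>
            (\<lambda>n. s n * frac_curv (s n) x (En n)) \<longlonglongrightarrow> dim_omega TYPE('a)) \<and>
         (bounded (UNIV - E) \<longrightarrow>
            (\<lambda>n. frac_curv (s n) x (En n) + dim_omega TYPE('a) / s n) \<longlonglongrightarrow> frac_curv0 x E \<and>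
            (\<lambda>n. s n * frac_curv (s n) x (En n)) \<longlonglongrightarrow> - dim_omega TYPE('a))"
proof (intro conjI impI)
  have s: "0 < s n" for n using assms(4) by blast
  note limit = frac_curv_renormalized_limit[OF assms(1) s assms(5-10)]
  \<comment> \<open>Displacements are eventually at most 1, whence the radius \<open>R + 1\<close>
    below.\<close>
  note subset = converges_C_eventually_subset_ball[OF assms(8) zero_less_one]
  note mult = tendsto_mult_of_renormalized[OF s assms(5)]
  {
    assume "bounded E"
    then obtain R where R: "0 < R" "E \<subseteq> ball x R" by (auto dest: bounded_subset_ballD[of _ x])
    have "(\<lambda>n. frac_curv (s n) x (En n) - 1 * (dim_omega TYPE('a) / s n)) \<longlonglongrightarrow>
        Lim at_top (\<lambda>R. trunc_curv0 R x E - 1 * (dim_omega TYPE('a) * ln R))"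
    proof (rule limit)
      show "0 < R + 1" using R by simp
      show "phase E y = 1" if "y \<notin> ball x (R + 1)" for y
        using that R(2) subset_ball[of R "R + 1" x] by (intro phase_simps) (simp del: mem_ball, blast)
      show "\<forall>\<^sub>F n in sequentially. \<forall>y. y \<notin> ball x (R + 1) \<longrightarrow> phase (En n) y = 1"
        using subset[of x R]
      proof eventually_elim
        case (elim n)
        then have "y \<notin> En n" if "y \<notin> ball x (R + 1)" for y using R that by blast
        then show ?case by (simp del: mem_ball)
      qed
    qed
    then show "(\<lambda>n. frac_curv (s n) x (En n) - dim_omega TYPE('a) / s n) \<longlonglongrightarrow> frac_curv0 x E"
      using \<open>bounded E\<close> by (simp add: frac_curv0_def)
    then show "(\<lambda>n. s n * frac_curv (s n) x (En n)) \<longlonglongrightarrow> dim_omega TYPE('a)" by (rule mult)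
  }
  {
    assume bd: "bounded (UNIV - E)"
    \<comment> \<open>\<open>frac_curv0\<close> tests boundedness of \<open>E\<close> first, so its
      second branch is reached only for unbounded \<open>E\<close>; the whole space is not a union
      of two bounded sets.\<close>
    have "\<not> bounded E"
    proof
      assume "bounded E"
      with bd have "bounded (E \<union> (UNIV - E))" by (simp only: bounded_Un)
      then show False by simp
    qed
    from bd obtain R where R: "0 < R" "- E \<subseteq> ball x R"
      by (auto dest: bounded_subset_ballD[of _ x] simp: Compl_eq_Diff_UNIV)
    \<comment> \<open>The factor \<open>- 1\<close> is left unsimplified to match
      \<open>\<sigma>\<close> in the general limit.\<close>
    have "(\<lambda>n. frac_curv (s n) x (En n) - - 1 * (dim_omega TYPE('a) / s n)) \<longlonglongrightarrow>
        Lim at_top (\<lambda>R. trunc_curv0 R x E - - 1 * (dim_omega TYPE('a) * ln R))"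
    proof (rule limit)
      show "0 < R + 1" using R by simp
      show "phase E y = - 1" if "y \<notin> ball x (R + 1)" for y
        using that R(2) subset_ball[of R "R + 1" x] by (intro phase_simps) (simp del: mem_ball, blast)
      show "\<forall>\<^sub>F n in sequentially. \<forall>y. y \<notin> ball x (R + 1) \<longrightarrow> phase (En n) y = - 1"
        using subset[of x R]
      proof eventually_elim
        case (elim n)
        then have "y \<in> En n" if "y \<notin> ball x (R + 1)" for y using R that by blast
        then show ?case by (simp del: mem_ball)
      qed
    qed
    then show "(\<lambda>n. frac_curv (s n) x (En n) + dim_omega TYPE('a) / s n) \<longlonglongrightarrow> frac_curv0 x E"
      using bd \<open>\<not> bounded E\<close> by (simp add: frac_curv0_def)
    then show "(\<lambda>n. s n * frac_curv (s n) x (En n)) \<longlonglongrightarrow> - dim_omega TYPE('a)"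
      by (intro mult) simp
  }
qed

end
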